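(* Let $G$ be a countable amenable group, $\mathscr A$ a finite discrete space, and let $G$ act on $\mathscr A^G$ by the shift. Then the function $x\mapsto h(x)=h_{\mathrm{top}}(\overline{Gx},G)$ is continuous on $\mathscr A^G$ with respect to the pseudometric $D^*$ (and the usual metric on $\mathbb R$).
   Context: $G$ is a discrete countable amenable group. The shift action of $G$ on the product space $\mathscr A^G$ is $(h,(x_g)_{g\in G})\mapsto(x_{gh})_{g\in G}$. $\overline{Gx}$ is the closure of the orbit of $x$. $\mathrm{Fin}(G)$ is the family of non-empty finite subsets of $G$. Upper Banach density of $A\subset G$: $D^*(A)=\inf_{F\in\mathrm{Fin}(G)}\sup_{g\in G}|A\cap Fg|/|F|$. The pseudometric $D^*$ on $\mathscr A^G$ is $D^*(x,x')=D^*(\{g\in G:x_g\ne x'_g\})$. A (left) Følner sequence is a sequence $\{F_n\}\subset\mathrm{Fin}(G)$ with $|gF_n\triangle F_n|/|F_n|\to0$ for every $g\in G$. Topological entropy: for a dynamical system $(Y,G)$ and an open cover $\mathcal U$ of $Y$, let $\mathcal N(\mathcal U)$ be the minimal cardinality of a subcover, and for $F\in\mathrm{Fin}(G)$ let $\mathcal U^F=\bigvee_{f\in F}f^{-1}\mathcal U$ (common refinement). Then $h(Y,G,\mathcal U)=\lim_n\log\mathcal N(\mathcal U^{F_n})/|F_n|$ (the limit exists and is independent of the Følner sequence) and $h_{\mathrm{top}}(Y,G)=\sup_{\mathcal U}h(Y,G,\mathcal U)$. *)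

theory Defs
  imports "HOL-Analysis.Analysis" "HOL-Algebra.Algebra"
begin

definition Fin :: "('g, 'm) monoid_scheme \<Rightarrow> 'g set set" where
  "Fin G = {F. F \<noteq> {} \<and> finite F \<and> F \<subseteq> carrier G}"

definition folner_seq :: "('g, 'm) monoid_scheme \<Rightarrow> (nat \<Rightarrow> 'g set) \<Rightarrow> bool" where
  "folner_seq G F \<longleftrightarrow>
     (\<forall>n. F n \<in> Fin G) \<and>
     (\<forall>g\<in>carrier G.
        (\<lambda>n. real (card (sym_diff (g <#\<^bsub>G\<^esub> F n) (F n))) / real (card (F n))) \<longlonglongrightarrow> 0)"

text \<open>Amenability in the Folner form; it is meant for countable discrete groups only.\<close>

definition amenable :: "('g, 'm) monoid_scheme \<Rightarrow> bool" where
  "amenable G \<longleftrightarrow> (\<exists>F. folner_seq G F)"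

definition upper_banach_density :: "('g, 'm) monoid_scheme \<Rightarrow> 'g set \<Rightarrow> real" where
  "upper_banach_density G A =
     (INF F\<in>Fin G. SUP g\<in>carrier G. real (card (A \<inter> (F #>\<^bsub>G\<^esub> g))) / real (card F))"

definition Dstar :: "('g, 'm) monoid_scheme \<Rightarrow> ('g \<Rightarrow> 'a) \<Rightarrow> ('g \<Rightarrow> 'a) \<Rightarrow> real" where
  "Dstar G x x' = upper_banach_density G {g \<in> carrier G. x g \<noteq> x' g}"

definition open_cover :: "'y topology \<Rightarrow> 'y set set \<Rightarrow> bool" where
  "open_cover T U \<longleftrightarrow> (\<forall>u\<in>U. openin T u) \<and> \<Union>U = topspace T"

text \<open>Meaningful only if a finite subcover exists, e.g. for open covers of compact spaces.\<close>

definition cover_number :: "'y topology \<Rightarrow> 'y set set \<Rightarrow> nat" where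
  "cover_number T U =
     (LEAST n. \<exists>V\<subseteq>U. finite V \<and> card V = n \<and> \<Union>V = topspace T)"

text \<open>The join over \<open>f \<in> F\<close> of the covers \<open>f\<^sup>-\<^sup>1U\<close>: its members are the intersections of one
  preimage \<open>f\<^sup>-\<^sup>1(c f)\<close>, taken in the space, for each \<open>f \<in> F\<close>.\<close>

definition join_cover ::
  "'y topology \<Rightarrow> ('g \<Rightarrow> 'y \<Rightarrow> 'y) \<Rightarrow> 'y set set \<Rightarrow> 'g set \<Rightarrow> 'y set set" where
  "join_cover T act U F = {{y \<in> topspace T. \<forall>f\<in>F. act f y \<in> c f} | c. c \<in> F \<rightarrow> U}"

text \<open>The common limit along all Folner sequences.\<close>

definition cover_entropy ::
  "('g, 'm) monoid_scheme \<Rightarrow> 'y topology \<Rightarrow> ('g \<Rightarrow> 'y \<Rightarrow> 'y) \<Rightarrow> 'y set set \<Rightarrow> real" where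
  "cover_entropy G T act U =
     (THE L. \<forall>F. folner_seq G F \<longrightarrow>
        (\<lambda>n. ln (real (cover_number T (join_cover T act U (F n)))) / real (card (F n)))
          \<longlonglongrightarrow> L)"

definition top_entropy ::
  "('g, 'm) monoid_scheme \<Rightarrow> 'y topology \<Rightarrow> ('g \<Rightarrow> 'y \<Rightarrow> 'y) \<Rightarrow> ereal" where
  "top_entropy G T act = (SUP U\<in>{U. open_cover T U}. ereal (cover_entropy G T act U))"

definition full_shift :: "('g, 'm) monoid_scheme \<Rightarrow> 'a set \<Rightarrow> ('g \<Rightarrow> 'a) topology" where
  "full_shift G A = product_topology (\<lambda>_. discrete_topology A) (carrier G)"

definition shift :: "('g, 'm) monoid_scheme \<Rightarrow> 'g \<Rightarrow> ('g \<Rightarrow> 'a) \<Rightarrow> 'g \<Rightarrow> 'a" where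
  "shift G h x = (\<lambda>g\<in>carrier G. x (g \<otimes>\<^bsub>G\<^esub> h))"

definition orbit_closure ::
  "('g, 'm) monoid_scheme \<Rightarrow> 'a set \<Rightarrow> ('g \<Rightarrow> 'a) \<Rightarrow> ('g \<Rightarrow> 'a) set" where
  "orbit_closure G A x = full_shift G A closure_of ((\<lambda>h. shift G h x) ` carrier G)"

definition orbit_entropy ::
  "('g, 'm) monoid_scheme \<Rightarrow> 'a set \<Rightarrow> ('g \<Rightarrow> 'a) \<Rightarrow> ereal" where
  "orbit_entropy G A x =
     top_entropy G (subtopology (full_shift G A) (orbit_closure G A x)) (shift G)"

end

theory Submission imports Defs begin

text \<open>
  Write \<open>p\<^sub>x(F)\<close> for the number of patterns \<open>(x\<^bsub>fg\<^esub>)\<^bsub>f \<in> F\<^esub>\<close>, \<open>g \<in> G\<close>, that \<open>x\<close> shows on the right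
  translates of a finite set \<open>F\<close>. Two facts give the continuity. The entropy \<open>h(x)\<close> is the
  exponential growth rate of \<open>p\<^sub>x\<close> along Folner sequences. If \<open>D\<^sup>*(x, x') < d\<close>, then on every
  translate of a late Folner set \<open>F\<close> the elements \<open>x\<close> and \<open>x'\<close> differ in at most \<open>2d|F|\<close> places;
  so each pattern of \<open>x'\<close> lies in a Hamming ball of relative radius \<open>2d\<close> around a pattern of \<open>x\<close>,
  and the growth rate of the size of these balls tends to \<open>0\<close> with \<open>d\<close>. The comparison
  (\<open>orbit_entropy_perturb\<close>) is symmetric in \<open>x\<close> and \<open>x'\<close>, and its bound is uniform in both.

  For the growth rate (\<open>orbit_entropy_eq_pattern_growth\<close>) one compares an arbitrary open cover
  \<open>U\<close> of the orbit closure with the partition by the letter at \<open>1\<close>. The join of the latter over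
  \<open>F\<close> is the partition into patterns on \<open>F\<close>, so its covering number is \<open>p\<^sub>x(F)\<close>. By compactness
  the pattern of a point on some finite set \<open>K\<close> determines a member of \<open>U\<close> containing it, so the
  covering number of \<open>U\<^sup>F\<close> is at most \<open>p\<^sub>x(KF) \<le> p\<^sub>x(F) |A|\<^bsup>|KF - F|\<^esup>\<close>, and \<open>|KF - F|\<close> is
  negligible against \<open>|F|\<close>.

  All this rests on the existence of the limits that define the entropy of a cover, independently of
  the Folner sequence. This is the Ornstein-Weiss lemma (\<open>ornstein_weiss\<close>) for the function
  \<open>F \<mapsto> ln N(U\<^sup>F)\<close>, which is subadditive and invariant under right translations. Its proof is a greedy
  quasi-tiling: finitely many shapes on which the mean of the function is almost
  minimal are chosen, each almost invariant under the inverses of the smaller ones; placing translates from the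
  largest shape down to the smallest, with little overlap, fills up almost all of any sufficiently
  invariant set.
\<close>

section \<open>Translates in a group and Folner sequences\<close>

context group begin

lemma finite_set_mult:
  assumes "finite E" "finite K" shows "finite (E <#> K)"
  using assms by (auto simp: set_mult_def)

lemma card_set_mult_diff_le:
  assumes "finite E" "finite F"
  shows "card ((E <#> F) - F) \<le> (\<Sum>e\<in>E. card ((e <#\<^bsub>G\<^esub> F) - F))"
proof -
  have eq: "(E <#> F) - F = (\<Union>e\<in>E. (e <#\<^bsub>G\<^esub> F) - F)"
    by (auto simp: set_mult_def l_coset_def)
  show ?thesis unfolding eq by (rule card_UN_le[OF assms(1)])
qed

text \<open>The Folner condition, stated for single translates, controls products with a finite set \<open>E\<close>:
  \<open>E F - F\<close> is a finite union of sets \<open>e F - F\<close>.\<close>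

lemma folner_eventually_invariant:
  assumes F: "folner_seq G F" and E: "finite E" "E \<subseteq> carrier G" and "(\<eta>::real) > 0"
  shows "\<forall>\<^sub>F n in sequentially. real (card ((E <#> F n) - F n)) \<le> \<eta> * real (card (F n))"
proof -
  have fin: "finite (F n)" and pos: "0 < card (F n)" for n
    using F by (auto simp: folner_seq_def Fin_def card_gt_0_iff)
  have "(\<lambda>n. \<Sum>e\<in>E. real (card (sym_diff (e <#\<^bsub>G\<^esub> F n) (F n))) / real (card (F n))) \<longlonglongrightarrow> (\<Sum>e\<in>E. 0)"
    by (rule tendsto_sum) (use F E in \<open>auto simp: folner_seq_def\<close>)
  then have "\<forall>\<^sub>F n in sequentially. (\<Sum>e\<in>E. real (card (sym_diff (e <#\<^bsub>G\<^esub> F n) (F n))) / real (card (F n))) < \<eta>"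
    using \<open>\<eta> > 0\<close> by (intro order_tendstoD(2)) auto
  then show ?thesis
  proof eventually_elim
    case (elim n)
    have "real (card ((E <#> F n) - F n)) \<le> (\<Sum>e\<in>E. real (card ((e <#\<^bsub>G\<^esub> F n) - F n)))"
      using card_set_mult_diff_le[OF E(1) fin[of n]] by (metis of_nat_le_iff of_nat_sum)
    also have "\<dots> \<le> (\<Sum>e\<in>E. real (card (sym_diff (e <#\<^bsub>G\<^esub> F n) (F n))))"
      by (intro sum_mono of_nat_mono card_mono) (use fin in \<open>auto simp: l_coset_def\<close>)
    also have "\<dots> = (\<Sum>e\<in>E. real (card (sym_diff (e <#\<^bsub>G\<^esub> F n) (F n))) / real (card (F n))) * real (card (F n))"
      using pos[of n] by (simp flip: sum_divide_distrib)
    also have "\<dots> \<le> \<eta> * real (card (F n))"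
      by (rule mult_right_mono[OF less_imp_le[OF elim]]) simp
    finally show ?case .
  qed
qed

lemma card_r_coset:
  assumes "K \<subseteq> carrier G" "c \<in> carrier G" shows "card (K #> c) = card K"
proof -
  have "K #> c = (\<lambda>k. k \<otimes> c) ` K" by (auto simp: r_coset_def)
  moreover have "inj_on (\<lambda>k. k \<otimes> c) K" using assms by (auto intro!: inj_onI simp: subset_iff)
  ultimately show ?thesis by (simp add: card_image)
qed

text \<open>Double counting of the incidences \<open>k \<otimes> c \<in> D\<close> with \<open>k \<in> K\<close> and \<open>c \<in> C\<close>.\<close>

lemma sum_card_translates_eq:
  assumes "finite K" "K \<subseteq> carrier G" "finite C" "C \<subseteq> carrier G"
  shows "(\<Sum>c\<in>C. card ((K #> c) \<inter> D)) = (\<Sum>k\<in>K. card {c\<in>C. k \<otimes> c \<in> D})"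
proof -
  have "card ((K #> c) \<inter> D) = card {k\<in>K. k \<otimes> c \<in> D}" if "c \<in> C" for c
  proof -
    have "(K #> c) \<inter> D = (\<lambda>k. k \<otimes> c) ` {k\<in>K. k \<otimes> c \<in> D}" by (auto simp: r_coset_def)
    moreover have "inj_on (\<lambda>k. k \<otimes> c) {k\<in>K. k \<otimes> c \<in> D}"
      using assms that by (auto intro!: inj_onI simp: subset_iff)
    ultimately show ?thesis by (simp add: card_image)
  qed
  then have "(\<Sum>c\<in>C. card ((K #> c) \<inter> D)) = (\<Sum>c\<in>C. \<Sum>k\<in>K. if k \<otimes> c \<in> D then 1 else 0)"
    using assms by (simp add: sum.If_cases Int_def)
  also have "\<dots> = (\<Sum>k\<in>K. \<Sum>c\<in>C. if k \<otimes> c \<in> D then 1 else 0)"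
    by (rule sum.swap)
  also have "\<dots> = (\<Sum>k\<in>K. card {c\<in>C. k \<otimes> c \<in> D})"
    using assms by (simp add: sum.If_cases Int_def)
  finally show ?thesis .
qed

lemma sum_card_translates_le:
  assumes "finite K" "K \<subseteq> carrier G" "finite C" "C \<subseteq> carrier G" "finite D"
  shows "(\<Sum>c\<in>C. card ((K #> c) \<inter> D)) \<le> card K * card D"
proof -
  have "(\<Sum>k\<in>K. card {c\<in>C. k \<otimes> c \<in> D}) \<le> (\<Sum>k\<in>K. card D)"
  proof (rule sum_mono)
    fix k assume "k \<in> K"
    then show "card {c\<in>C. k \<otimes> c \<in> D} \<le> card D"
      using assms by (intro card_inj_on_le[of "\<lambda>c. k \<otimes> c"]) (auto intro!: inj_onI simp: subset_iff)
  qed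
  then show ?thesis using assms by (simp add: sum_card_translates_eq)
qed

end

section \<open>Convergence of subadditive functions along Folner sequences\<close>

text \<open>The intended \<open>h\<close> is \<open>F \<mapsto> ln N(U\<^sup>F)\<close>. Invariance under translations is required as an inequality;
  equality follows by translating back.\<close>

locale right_invariant_subadditive = group +
  fixes h :: "'a set \<Rightarrow> real"
  assumes h_empty: "h {} = 0"
    and h_nonneg: "\<lbrakk>finite B; B \<subseteq> carrier G\<rbrakk> \<Longrightarrow> 0 \<le> h B"
    and h_Un: "\<lbrakk>finite B; B \<subseteq> carrier G; finite C; C \<subseteq> carrier G\<rbrakk> \<Longrightarrow> h (B \<union> C) \<le> h B + h C"
    and h_r_coset: "\<lbrakk>finite B; B \<subseteq> carrier G; g \<in> carrier G\<rbrakk> \<Longrightarrow> h (B #> g) \<le> h B"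
begin

lemma h_le_card:
  assumes "finite B" "B \<subseteq> carrier G" shows "h B \<le> h {\<one>} * real (card B)"
  using assms
proof (induction B rule: finite_induct)
  case empty then show ?case by (simp add: h_empty)
next
  case (insert b B)
  have "h {b} \<le> h {\<one>}" using h_r_coset[of "{\<one>}" b] insert by (simp add: r_coset_def)
  moreover have "h (insert b B) \<le> h {b} + h B" using h_Un[of "{b}" B] insert by simp
  ultimately show ?case using insert by (simp add: algebra_simps)
qed

text \<open>A shape \<open>K\<close> is good when the mean of \<open>h\<close> over it is at most \<open>l\<close> and left translation by \<open>E\<close>
  hardly moves it. In the tiling, \<open>E\<close> consists of the inverses of the shapes that are still to be
  placed, so that few of their translates straddle the boundary of a translate of \<open>K\<close>.\<close>

definition tile_shape :: "real \<Rightarrow> real \<Rightarrow> 'a set \<Rightarrow> 'a set \<Rightarrow> bool" where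
  "tile_shape l \<epsilon> E K \<longleftrightarrow>
     K \<in> Fin G \<and> real (card ((E <#> K) - K)) \<le> \<epsilon> * card K \<and> h K \<le> l * card K"

text \<open>The two bounds of a good shape, weakened by the factor \<open>1 / (1 - \<epsilon>)\<close> that pays for overlaps: a
  tile is added only if at least the fraction \<open>1 - \<epsilon>\<close> of its points is new. Recording these bounds
  for a union of tiles makes it unnecessary to remember the tiles themselves.\<close>

definition tiled :: "real \<Rightarrow> real \<Rightarrow> 'a set \<Rightarrow> 'a set \<Rightarrow> bool" where
  "tiled l \<epsilon> E C \<longleftrightarrow>
     real (card ((E <#> C) - C)) \<le> \<epsilon> / (1 - \<epsilon>) * card C \<and> h C \<le> l / (1 - \<epsilon>) * card C"

text \<open>Both \<open>h\<close> and the boundary \<open>E C - C\<close> are subadditive in \<open>C\<close>, and the contribution of the tile is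
  proportional to \<open>|K|\<close>, hence to the number of new points.\<close>

lemma tiled_Un_tile:
  assumes K: "tile_shape l \<epsilon> E K" and C: "tiled l \<epsilon> E C" "finite C" "C \<subseteq> carrier G"
    and E: "finite E" "E \<subseteq> carrier G" and c: "c \<in> carrier G"
    and e: "0 < \<epsilon>" "\<epsilon> < 1" and l: "0 \<le> l"
    and new: "(1 - \<epsilon>) * card K \<le> card ((K #> c) - C)"
  shows "tiled l \<epsilon> E (C \<union> (K #> c))"
proof -
  have Kf: "finite K" "K \<subseteq> carrier G" using K by (auto simp: tile_shape_def Fin_def)
  have Kcf: "finite (K #> c)" "K #> c \<subseteq> carrier G" using Kf c by (auto simp: r_coset_def)
  have cardU: "card (C \<union> (K #> c)) = card C + card ((K #> c) - C)"
    using C Kcf by (metis card_Un_disjoint Un_Diff_cancel Diff_disjoint finite_Diff)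
  have K_le: "real (card K) \<le> card ((K #> c) - C) / (1 - \<epsilon>)"
    using new e by (simp add: field_simps)
  have "(E <#> (K #> c)) - (K #> c) \<subseteq> ((E <#> K) - K) #> c"
  proof
    fix y assume "y \<in> (E <#> (K #> c)) - (K #> c)"
    then obtain a k where *: "a \<in> E" "k \<in> K" "y = a \<otimes> (k \<otimes> c)" "y \<notin> K #> c"
      by (auto simp: set_mult_def r_coset_def)
    then have y: "y = (a \<otimes> k) \<otimes> c" using E Kf c by (simp add: m_assoc subset_iff)
    with * have "a \<otimes> k \<notin> K" by (auto simp: r_coset_def)
    with * have "a \<otimes> k \<in> (E <#> K) - K" by (auto simp: set_mult_def)
    with y show "y \<in> ((E <#> K) - K) #> c" unfolding r_coset_def by blast
  qed
  moreover have "(E <#> K) - K \<subseteq> carrier G" "finite ((E <#> K) - K)"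
    using E Kf by (auto simp: set_mult_def)
  ultimately have bd: "card ((E <#> (K #> c)) - (K #> c)) \<le> card ((E <#> K) - K)"
    by (metis card_mono card_r_coset[OF _ c] finite_surj r_coset_def finite_UN finite.intros)
  have "(E <#> (C \<union> (K #> c))) - (C \<union> (K #> c)) \<subseteq> ((E <#> C) - C) \<union> ((E <#> (K #> c)) - (K #> c))"
    by (auto simp: set_mult_def)
  then have "card ((E <#> (C \<union> (K #> c))) - (C \<union> (K #> c)))
      \<le> card (((E <#> C) - C) \<union> ((E <#> (K #> c)) - (K #> c)))"
    by (intro card_mono) (use E C Kcf in \<open>auto simp: set_mult_def\<close>)
  also have "\<dots> \<le> card ((E <#> C) - C) + card ((E <#> (K #> c)) - (K #> c))"
    by (rule card_Un_le)
  finally have "real (card ((E <#> (C \<union> (K #> c))) - (C \<union> (K #> c))))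
      \<le> real (card ((E <#> C) - C)) + real (card ((E <#> K) - K))"
    using bd by linarith
  also have "\<dots> \<le> \<epsilon> / (1 - \<epsilon>) * card C + \<epsilon> * card K"
    using C(1) K by (simp add: tiled_def tile_shape_def)
  also have "\<dots> \<le> \<epsilon> / (1 - \<epsilon>) * card C + \<epsilon> * (card ((K #> c) - C) / (1 - \<epsilon>))"
    using K_le e by (intro add_left_mono mult_left_mono) auto
  also have "\<dots> = \<epsilon> / (1 - \<epsilon>) * card (C \<union> (K #> c))"
    by (simp add: cardU algebra_simps)
  finally have 1: "real (card ((E <#> (C \<union> (K #> c))) - (C \<union> (K #> c))))
      \<le> \<epsilon> / (1 - \<epsilon>) * card (C \<union> (K #> c))" .
  have "h (C \<union> (K #> c)) \<le> h C + h K"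
    using h_Un[OF C(2,3) Kcf] h_r_coset[OF Kf c] by linarith
  also have "\<dots> \<le> l / (1 - \<epsilon>) * card C + l * card K"
    using C(1) K by (simp add: tiled_def tile_shape_def)
  also have "\<dots> \<le> l / (1 - \<epsilon>) * card C + l * (card ((K #> c) - C) / (1 - \<epsilon>))"
    using K_le l by (intro add_left_mono mult_left_mono) auto
  also have "\<dots> = l / (1 - \<epsilon>) * card (C \<union> (K #> c))"
    by (simp add: cardU algebra_simps)
  finally show ?thesis using 1 by (simp add: tiled_def)
qed

text \<open>One round of the greedy tiling: translates of \<open>K\<close> are added to \<open>C\<close> inside \<open>F\<close> as long as they
  overlap little with what is there. When this stops, every translate of \<open>K\<close> inside \<open>F\<close> that avoids
  \<open>C\<close> meets the added part in at least \<open>\<epsilon> |K|\<close> points. There are almost \<open>|F - C|\<close> such translates,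
  and each added point lies in at most \<open>|K|\<close> of them; hence the round fills at least about the
  fraction \<open>\<epsilon>\<close> of \<open>F - C\<close>. The error \<open>3 \<epsilon> |F|\<close> counts the translates that leave \<open>F\<close> or meet \<open>C\<close>.\<close>

lemma tiled_extend:
  fixes l \<epsilon> :: real
  assumes K: "tile_shape l \<epsilon> E K" and C: "tiled l \<epsilon> (E \<union> set_inv K) C" "C \<subseteq> F"
    and E: "finite E" "E \<subseteq> carrier G" and F: "finite F" "F \<subseteq> carrier G"
    and e: "0 < \<epsilon>" "\<epsilon> \<le> 1/2" and l: "0 \<le> l"
    and inv: "card K * real (card ((K <#> F) - F)) \<le> \<epsilon> * card F"
  shows "\<exists>D. tiled l \<epsilon> E D \<and> D \<subseteq> F \<and>
    real (card (F - D)) \<le> (1 - \<epsilon>) * card (F - C) + \<epsilon> * (3 * \<epsilon> * card F)"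
proof -
  have Kf: "finite K" "K \<subseteq> carrier G" "K \<noteq> {}" using K by (auto simp: tile_shape_def Fin_def)
  have Cf: "finite C" "C \<subseteq> carrier G" using C F finite_subset by auto
  have e1: "\<epsilon> < 1" using e by simp
  have C_E: "tiled l \<epsilon> E C"
  proof -
    have "card ((E <#> C) - C) \<le> card (((E \<union> set_inv K) <#> C) - C)"
      by (intro card_mono) (use E Kf Cf in \<open>auto simp: set_mult_def SET_INV_def\<close>)
    then show ?thesis using C(1) by (simp add: tiled_def)
  qed
  \<comment> \<open>A maximal tiled set exists because its cardinality is bounded by that of \<open>F\<close>.\<close>
  define \<D> where "\<D> = {D. tiled l \<epsilon> E D \<and> C \<subseteq> D \<and> D \<subseteq> F}"
  have "C \<in> \<D>" using C_E C by (simp add: \<D>_def)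
  moreover have "card D \<le> card F" if "D \<in> \<D>" for D
    using that F by (auto simp: \<D>_def intro: card_mono)
  ultimately obtain D where D: "D \<in> \<D>" and Dmax: "\<And>D'. D' \<in> \<D> \<Longrightarrow> card D' \<le> card D"
    using ex_has_greatest_nat[of "\<lambda>D. D \<in> \<D>" C card "Suc (card F)"]
    by (auto simp: less_Suc_eq_le)
  have Df: "finite D" "D \<subseteq> carrier G" "D \<subseteq> F" "C \<subseteq> D" "tiled l \<epsilon> E D"
    using D F finite_subset by (auto simp: \<D>_def)
  \<comment> \<open>Otherwise the translate of \<open>K\<close> could still be added to \<open>D\<close>, against its maximality.\<close>
  have hit: "\<epsilon> * card K \<le> card ((K #> c) \<inter> (D - C))"
    if c: "c \<in> F" "K #> c \<subseteq> F" "(K #> c) \<inter> C = {}" for c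
  proof (rule ccontr)
    assume neg: "\<not> ?thesis"
    have cG: "c \<in> carrier G" using c F by auto
    have "card ((K #> c) - D) + card ((K #> c) \<inter> D) = card K"
      using card_Diff_subset_Int[of "K #> c" D] card_r_coset[OF Kf(2) cG] c(2) F(1)
      by (metis add.commute card_Int_Diff finite_subset)
    moreover have "(K #> c) \<inter> D = (K #> c) \<inter> (D - C)" using c by auto
    ultimately have new: "(1 - \<epsilon>) * card K < card ((K #> c) - D)"
      using neg by (simp add: algebra_simps flip: of_nat_add)
    have "tiled l \<epsilon> E (D \<union> (K #> c))"
      using tiled_Un_tile[OF K Df(5,1,2) E cG e(1) e1 l] new by simp
    then have "D \<union> (K #> c) \<in> \<D>" using Df c by (auto simp: \<D>_def)
    from Dmax[OF this] have "D \<union> (K #> c) = D"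
      using F c Df by (metis Un_upper1 card_seteq finite_Un finite_subset)
    then have "card ((K #> c) - D) = 0" by (metis Diff_eq_empty_iff card.empty Un_upper2)
    moreover have "0 \<le> (1 - \<epsilon>) * card K" using e1 by simp
    ultimately show False using new by simp
  qed
  define S where "S = {c \<in> F - C. K #> c \<subseteq> F \<and> (K #> c) \<inter> C = {}}"
  have Sf: "finite S" "S \<subseteq> carrier G" "S \<subseteq> F - C" using F by (auto simp: S_def)
  have S_large: "real (card (F - C)) \<le> card S + 3 * \<epsilon> * card F"
  proof -
    \<comment> \<open>Translates that leave \<open>F\<close>: each has a point in the boundary \<open>K F - F\<close>.\<close>
    define B where "B = {c \<in> F. \<not> K #> c \<subseteq> F}"
    have Bf: "finite B" "B \<subseteq> carrier G" using F by (auto simp: B_def)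
    have "card B \<le> (\<Sum>c\<in>B. card ((K #> c) \<inter> ((K <#> F) - F)))"
    proof -
      have "1 \<le> card ((K #> c) \<inter> ((K <#> F) - F))" if "c \<in> B" for c
      proof -
        have "(K #> c) \<inter> ((K <#> F) - F) \<noteq> {}" "finite (K #> c)"
          using that Kf by (auto simp: B_def r_coset_def set_mult_def)
        then show ?thesis by (simp add: Suc_leI card_gt_0_iff)
      qed
      from sum_mono[OF this] show ?thesis by simp
    qed
    also have "\<dots> \<le> card K * card ((K <#> F) - F)"
      using sum_card_translates_le[OF Kf(1,2) Bf] Kf(1) F(1) by (simp add: finite_set_mult)
    finally have "real (card B) \<le> real (card K * card ((K <#> F) - F))"
      by (rule of_nat_mono)
    with inv have B_le: "real (card B) \<le> \<epsilon> * card F" by simp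
    \<comment> \<open>Translates that meet \<open>C\<close> from outside have their base point in \<open>K\<^sup>-\<^sup>1 C - C\<close>.\<close>
    define B' where "B' = {c \<in> F - C. (K #> c) \<inter> C \<noteq> {}}"
    have "B' \<subseteq> ((E \<union> set_inv K) <#> C) - C"
    proof
      fix c assume c: "c \<in> B'"
      then obtain k where k: "k \<in> K" "k \<otimes> c \<in> C" by (auto simp: B'_def r_coset_def)
      have "c = inv k \<otimes> (k \<otimes> c)" using k c F Kf by (auto simp: B'_def m_assoc[symmetric] subset_iff)
      then show "c \<in> ((E \<union> set_inv K) <#> C) - C"
        using k c by (auto simp: B'_def set_mult_def SET_INV_def)
    qed
    then have "card B' \<le> card (((E \<union> set_inv K) <#> C) - C)"
      using E Kf Cf by (intro card_mono) (auto simp: set_mult_def SET_INV_def)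
    then have "real (card B') \<le> \<epsilon> / (1 - \<epsilon>) * card C"
      using C(1) unfolding tiled_def by linarith
    also have "\<dots> \<le> (2 * \<epsilon>) * card F"
    proof (rule mult_mono)
      show "\<epsilon> / (1 - \<epsilon>) \<le> 2 * \<epsilon>" using e by (simp add: field_simps)
      show "real (card C) \<le> real (card F)" using C F by (simp add: card_mono)
    qed (use e in auto)
    finally have B'_le: "real (card B') \<le> (2 * \<epsilon>) * card F" .
    have "F - C \<subseteq> S \<union> (B \<union> B')" by (auto simp: S_def B_def B'_def)
    then have "card (F - C) \<le> card (S \<union> (B \<union> B'))"
      using Sf Bf F by (intro card_mono) (auto simp: B'_def)
    also have "\<dots> \<le> card S + (card B + card B')"
      using card_Un_le[of S "B \<union> B'"] card_Un_le[of B B'] by linarith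
    finally show ?thesis using B_le B'_le by linarith
  qed
  have "real (card S) * (\<epsilon> * card K) \<le> (\<Sum>c\<in>S. real (card ((K #> c) \<inter> (D - C))))"
    using sum_bounded_below[of S "\<epsilon> * card K" "\<lambda>c. real (card ((K #> c) \<inter> (D - C)))"] hit
    by (auto simp: S_def)
  also have "\<dots> \<le> real (card K * card (D - C))"
    using sum_card_translates_le[OF Kf(1,2) Sf(1,2), of "D - C"] Df
    by (metis finite_Diff of_nat_mono of_nat_sum)
  finally have "(\<epsilon> * card S) * card K \<le> card (D - C) * real (card K)"
    by (simp add: mult_ac)
  then have "\<epsilon> * card S \<le> card (D - C)"
    using Kf by (simp add: card_gt_0_iff)
  moreover have "card (F - C) = card (F - D) + card (D - C)"
  proof -
    have "F - C = (F - D) \<union> (D - C)" using Df by auto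
    then show ?thesis using F Df by (metis Diff_disjoint Int_Diff card_Un_disjoint finite_Diff inf_commute)
  qed
  moreover have "\<epsilon> * card (F - C) \<le> \<epsilon> * (card S + 3 * \<epsilon> * card F)"
    using S_large e by (intro mult_left_mono) auto
  ultimately have "real (card (F - D)) \<le> (1 - \<epsilon>) * card (F - C) + \<epsilon> * (3 * \<epsilon> * card F)"
    by (simp add: algebra_simps)
  then show ?thesis using Df by blast
qed

text \<open>Induction on the number \<open>N\<close> of shapes. The shape \<open>K\<close> chosen in the induction step is the smallest
  one and is placed last: the first \<open>N\<close> rounds produce a set \<open>C\<close> that is invariant under
  \<open>K\<^sup>-\<^sup>1\<close> as well, and \<open>K\<close> fills a further fraction \<open>\<epsilon>\<close> of the rest. Since
  \<open>(1 - \<epsilon>) (3 \<epsilon>) + \<epsilon> (3 \<epsilon>) = 3 \<epsilon>\<close>, the errors do not accumulate.\<close>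

lemma eventually_tiled:
  fixes l \<epsilon> :: real
  assumes F: "folner_seq G F" and e: "0 < \<epsilon>" "\<epsilon> \<le> 1/2" and l: "0 \<le> l"
    and shapes: "\<And>E. finite E \<Longrightarrow> E \<subseteq> carrier G \<Longrightarrow> \<exists>K. tile_shape l \<epsilon> E K"
    and E: "finite E" "E \<subseteq> carrier G"
  shows "\<forall>\<^sub>F n in sequentially. \<exists>C. tiled l \<epsilon> E C \<and> C \<subseteq> F n \<and>
    real (card (F n - C)) \<le> ((1 - \<epsilon>) ^ N + 3 * \<epsilon>) * card (F n)"
  using E
proof (induction N arbitrary: E)
  case 0
  have "tiled l \<epsilon> E {}" by (simp add: tiled_def set_mult_def h_empty)
  moreover have "real (card (F n - {})) \<le> ((1 - \<epsilon>) ^ 0 + 3 * \<epsilon>) * card (F n)" for n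
    using e by (simp add: algebra_simps)
  ultimately show ?case by (intro always_eventually allI exI[of _ "{}"]) auto
next
  case (Suc N)
  obtain K where K: "tile_shape l \<epsilon> E K" using shapes Suc.prems by blast
  then have Kf: "finite K" "K \<subseteq> carrier G" "0 < card K"
    by (auto simp: tile_shape_def Fin_def card_gt_0_iff)
  have "finite (E \<union> set_inv K)" "E \<union> set_inv K \<subseteq> carrier G"
    using Suc.prems Kf by (auto simp: SET_INV_def)
  note IH = Suc.IH[OF this]
  have "\<epsilon> / card K > 0" using e Kf by simp
  from IH folner_eventually_invariant[OF F Kf(1,2) this] show ?case
  proof eventually_elim
    case (elim n)
    then obtain C where C: "tiled l \<epsilon> (E \<union> set_inv K) C" "C \<subseteq> F n"
      "real (card (F n - C)) \<le> ((1 - \<epsilon>) ^ N + 3 * \<epsilon>) * card (F n)" by blast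
    have Fn: "finite (F n)" "F n \<subseteq> carrier G" using F by (auto simp: folner_seq_def Fin_def)
    have inv: "card K * real (card ((K <#> F n) - F n)) \<le> \<epsilon> * card (F n)"
      using elim(2) Kf by (simp add: field_simps)
    obtain D where D: "tiled l \<epsilon> E D" "D \<subseteq> F n"
      "real (card (F n - D)) \<le> (1 - \<epsilon>) * card (F n - C) + \<epsilon> * (3 * \<epsilon> * card (F n))"
      using tiled_extend[OF K C(1,2) Suc.prems Fn e l inv] by blast
    have "(1 - \<epsilon>) * card (F n - C) \<le> (1 - \<epsilon>) * (((1 - \<epsilon>) ^ N + 3 * \<epsilon>) * card (F n))"
      using C(3) e by (intro mult_left_mono) auto
    then have "real (card (F n - D)) \<le> ((1 - \<epsilon>) ^ Suc N + 3 * \<epsilon>) * card (F n)"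
      using D(3) by (simp add: algebra_simps)
    then show ?case using D by blast
  qed
qed

text \<open>This condition on \<open>l\<close> mentions no Folner sequence, which is why the limit below is the same for all
  of them.\<close>

definition has_shapes :: "real \<Rightarrow> bool" where
  "has_shapes l \<longleftrightarrow> (\<forall>E \<eta>. finite E \<and> E \<subseteq> carrier G \<and> \<eta> > 0 \<longrightarrow> (\<exists>K. tile_shape l \<eta> E K))"

text \<open>After sufficiently many rounds the uncovered part of \<open>F n\<close> has at most \<open>4 \<epsilon> |F n|\<close> points. It
  contributes at most \<open>h {\<one>}\<close> per point, while the tiled part contributes at most \<open>l / (1 - \<epsilon>)\<close> per
  point; then let \<open>\<epsilon>\<close> tend to \<open>0\<close>.\<close>

lemma eventually_ratio_le:
  assumes F: "folner_seq G F" and l: "0 \<le> l" "has_shapes l" and "0 < e"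
  shows "\<forall>\<^sub>F n in sequentially. h (F n) / card (F n) \<le> l + e"
proof -
  define M where "M = h {\<one>}"
  have M: "0 \<le> M" unfolding M_def by (rule h_nonneg) auto
  have "((\<lambda>\<epsilon>. l / (1 - \<epsilon>) + 4 * M * \<epsilon>) \<longlongrightarrow> l / (1 - 0) + 4 * M * 0) (at_right 0)"
    by (intro tendsto_intros) auto
  then have "\<forall>\<^sub>F \<epsilon> in at_right 0. l / (1 - \<epsilon>) + 4 * M * \<epsilon> < l + e"
    using \<open>0 < e\<close> by (intro order_tendstoD(2)) auto
  moreover have "\<forall>\<^sub>F \<epsilon> in at_right (0::real). \<epsilon> \<in> {0<..<1/2}"
    by (rule eventually_at_right_real) simp
  ultimately obtain \<epsilon> where e: "0 < \<epsilon>" "\<epsilon> \<le> 1/2" "l / (1 - \<epsilon>) + 4 * M * \<epsilon> < l + e"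
    using eventually_happens'[OF trivial_limit_at_right_real eventually_conj, of _ 0]
    by (metis (no_types, lifting) greaterThanLessThan_iff less_imp_le)
  obtain N where N: "(1 - \<epsilon>) ^ N < \<epsilon>" using real_arch_pow_inv[of \<epsilon> "1 - \<epsilon>"] e by auto
  have "\<forall>\<^sub>F n in sequentially. \<exists>C. tiled l \<epsilon> {} C \<and> C \<subseteq> F n \<and>
    real (card (F n - C)) \<le> ((1 - \<epsilon>) ^ N + 3 * \<epsilon>) * card (F n)"
    by (rule eventually_tiled[OF F e(1,2) l(1)]) (use l e in \<open>auto simp: has_shapes_def\<close>)
  then show ?thesis
  proof eventually_elim
    case (elim n)
    then obtain C where C: "tiled l \<epsilon> {} C" "C \<subseteq> F n"
      "real (card (F n - C)) \<le> ((1 - \<epsilon>) ^ N + 3 * \<epsilon>) * card (F n)" by auto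
    have Fn: "finite (F n)" "F n \<subseteq> carrier G" "0 < card (F n)"
      using F by (auto simp: folner_seq_def Fin_def card_gt_0_iff)
    have Cf: "finite C" "C \<subseteq> carrier G" using C Fn finite_subset by auto
    have "h (F n) \<le> h C + h (F n - C)"
      using h_Un[of C "F n - C"] C Cf Fn by (simp add: Un_absorb1 subset_iff)
    also have "\<dots> \<le> l / (1 - \<epsilon>) * card C + M * card (F n - C)"
      using C(1) h_le_card[of "F n - C"] Fn by (intro add_mono) (auto simp: tiled_def M_def)
    also have "\<dots> \<le> l / (1 - \<epsilon>) * card (F n) + M * (4 * \<epsilon> * card (F n))"
    proof (intro add_mono mult_left_mono)
      have "((1 - \<epsilon>) ^ N + 3 * \<epsilon>) * card (F n) \<le> 4 * \<epsilon> * card (F n)"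
        using N by (intro mult_right_mono) auto
      then show "real (card (F n - C)) \<le> 4 * \<epsilon> * card (F n)" using C(3) by linarith
    qed (use C Fn M l e in \<open>auto simp: card_mono\<close>)
    also have "\<dots> = (l / (1 - \<epsilon>) + 4 * M * \<epsilon>) * card (F n)" by (simp add: algebra_simps)
    also have "\<dots> \<le> (l + e) * card (F n)" using e by (intro mult_right_mono) auto
    finally show ?case using Fn by (simp add: divide_simps)
  qed
qed

text \<open>The limit is the infimum of all \<open>l\<close> for which good shapes exist. The means of \<open>h\<close> along a Folner
  sequence eventually come close to any such \<open>l\<close> from above, and they cannot lie below the infimum by
  a fixed amount infinitely often, because the terms of the sequence would then be better shapes.\<close>

theorem ornstein_weiss:
  "\<exists>L. \<forall>F. folner_seq G F \<longrightarrow> (\<lambda>n. h (F n) / card (F n)) \<longlonglongrightarrow> L"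
proof (intro exI allI impI)
  let ?\<Lambda> = "{l. 0 \<le> l \<and> has_shapes l}"
  fix F assume F: "folner_seq G F"
  have Fn: "finite (F n)" "F n \<subseteq> carrier G" "0 < card (F n)" "F n \<in> Fin G" for n
    using F by (auto simp: folner_seq_def Fin_def card_gt_0_iff)
  \<comment> \<open>Terms of \<open>F\<close> are invariant enough to serve as shapes.\<close>
  have shapes: "has_shapes l" if "\<exists>\<^sub>F n in sequentially. h (F n) / card (F n) \<le> l" for l
    unfolding has_shapes_def
  proof (intro allI impI, elim conjE)
    fix E \<eta> assume "finite E" "E \<subseteq> carrier G" "(\<eta>::real) > 0"
    from frequently_ex[OF frequently_eventually_conj[OF that folner_eventually_invariant[OF F this]]]
    obtain n where "h (F n) / card (F n) \<le> l"
      "real (card ((E <#> F n) - F n)) \<le> \<eta> * real (card (F n))" by blast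
    then have "tile_shape l \<eta> E (F n)" using Fn[of n] by (simp add: tile_shape_def field_simps)
    then show "\<exists>K. tile_shape l \<eta> E K" by blast
  qed
  have "h (F n) / card (F n) \<le> h {\<one>}" for n
    using h_le_card[OF Fn(1,2)[of n]] Fn(3)[of n] by (simp add: field_simps)
  then have "has_shapes (h {\<one>})" by (intro shapes) (simp add: frequently_const_iff)
  then have ne: "?\<Lambda> \<noteq> {}" using h_nonneg[of "{\<one>}"] by auto
  have bdd: "bdd_below ?\<Lambda>" by (rule bdd_belowI[of _ 0]) auto
  show "(\<lambda>n. h (F n) / card (F n)) \<longlonglongrightarrow> Inf ?\<Lambda>"
  proof (rule tendstoI)
    fix e :: real assume "e > 0"
    then obtain l where l: "0 \<le> l" "has_shapes l" "l < Inf ?\<Lambda> + e / 2"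
      using cInf_lessD[OF ne, of "Inf ?\<Lambda> + e / 2"] by auto
    have "\<forall>\<^sub>F n in sequentially. \<not> h (F n) / card (F n) \<le> Inf ?\<Lambda> - e"
    proof (rule ccontr)
      assume "\<not> ?thesis"
      then have fr: "\<exists>\<^sub>F n in sequentially. h (F n) / card (F n) \<le> Inf ?\<Lambda> - e"
        by (simp add: frequently_def)
      obtain n where "h (F n) / card (F n) \<le> Inf ?\<Lambda> - e" using frequently_ex[OF fr] by blast
      then have "0 \<le> Inf ?\<Lambda> - e"
        using h_nonneg[OF Fn(1,2)[of n]] by (meson divide_nonneg_nonneg of_nat_0_le_iff order_trans)
      then have "Inf ?\<Lambda> \<le> Inf ?\<Lambda> - e" using shapes[OF fr] bdd by (intro cInf_lower) auto
      then show False using \<open>e > 0\<close> by simp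
    qed
    moreover have "\<forall>\<^sub>F n in sequentially. h (F n) / card (F n) \<le> l + e / 2"
      using eventually_ratio_le[OF F l(1,2)] \<open>e > 0\<close> by simp
    ultimately show "\<forall>\<^sub>F n in sequentially. dist (h (F n) / card (F n)) (Inf ?\<Lambda>) < e"
      by eventually_elim (use l in \<open>auto simp: dist_real_def\<close>)
  qed
qed

end

section \<open>Entropy of a cover\<close>

lemma cover_number_le:
  assumes "V \<subseteq> U" "finite V" "\<Union>V = topspace T"
  shows "cover_number T U \<le> card V"
  unfolding cover_number_def using assms by (intro Least_le) blast

lemma cover_number_attained:
  assumes "V \<subseteq> U" "finite V" "\<Union>V = topspace T"
  shows "\<exists>V'\<subseteq>U. finite V' \<and> card V' = cover_number T U \<and> \<Union>V' = topspace T"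
  unfolding cover_number_def
  by (rule LeastI[where P = "\<lambda>n. \<exists>V\<subseteq>U. finite V \<and> card V = n \<and> \<Union>V = topspace T"]) (use assms in blast)

text \<open>A finite cover that refines \<open>U\<close> bounds the covering number: enlarge each of its members to a
  member of \<open>U\<close>.\<close>

lemma finite_refinement:
  assumes W: "finite W" "topspace T \<subseteq> \<Union>W" "\<And>w. w \<in> W \<Longrightarrow> \<exists>u\<in>U. w \<subseteq> u"
    and U: "\<Union>U \<subseteq> topspace T"
  shows "\<exists>V\<subseteq>U. finite V \<and> \<Union>V = topspace T" "cover_number T U \<le> card W"
proof -
  obtain u where u: "\<And>w. w \<in> W \<Longrightarrow> u w \<in> U \<and> w \<subseteq> u w" using W(3) by metis
  have V: "u ` W \<subseteq> U" "finite (u ` W)" "\<Union>(u ` W) = topspace T"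
  proof -
    show "u ` W \<subseteq> U" "finite (u ` W)" using u W by auto
    show "\<Union>(u ` W) = topspace T" using u U W(2) by (auto simp: subset_iff) blast+
  qed
  then show "\<exists>V\<subseteq>U. finite V \<and> \<Union>V = topspace T" by blast
  have "cover_number T U \<le> card (u ` W)" by (rule cover_number_le[OF V])
  also have "\<dots> \<le> card W" by (rule card_image_le[OF W(1)])
  finally show "cover_number T U \<le> card W" .
qed

lemma cover_number_pos:
  assumes "V \<subseteq> U" "finite V" "\<Union>V = topspace T" "topspace T \<noteq> {}"
  shows "0 < cover_number T U"
proof -
  obtain V' where "finite V'" "card V' = cover_number T U" "\<Union>V' = topspace T"
    using cover_number_attained[OF assms(1-3)] by blast
  then show ?thesis using assms(4) by (metis Union_empty card_gt_0_iff)
qed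

lemma Union_join_cover_subset: "\<Union>(join_cover T act U F) \<subseteq> topspace T"
  by (auto simp: join_cover_def)

lemma join_coverI:
  "c \<in> F \<rightarrow> U \<Longrightarrow> {y \<in> topspace T. \<forall>f\<in>F. act f y \<in> c f} \<in> join_cover T act U F"
  unfolding join_cover_def by blast

text \<open>The existence of a finite subcover stands in for compactness. It passes from \<open>U\<close> to all joins
  \<open>U\<^sup>F\<close>, which makes their covering numbers meaningful.\<close>

locale action_cover = group +
  fixes T :: "'y topology" and act :: "'a \<Rightarrow> 'y \<Rightarrow> 'y" and U :: "'y set set"
  assumes nonempty: "topspace T \<noteq> {}"
    and act_closed: "\<lbrakk>g \<in> carrier G; y \<in> topspace T\<rbrakk> \<Longrightarrow> act g y \<in> topspace T"
    and act_mult: "\<lbrakk>g \<in> carrier G; k \<in> carrier G; y \<in> topspace T\<rbrakk> \<Longrightarrow>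
      act (g \<otimes> k) y = act g (act k y)"
    and finite_subcover: "\<exists>V\<subseteq>U. finite V \<and> \<Union>V = topspace T"
begin

lemma join_cover_finite_subcover:
  assumes F: "finite F" "F \<subseteq> carrier G"
  shows "\<exists>V\<subseteq>join_cover T act U F. finite V \<and> \<Union>V = topspace T"
proof -
  obtain V where V: "V \<subseteq> U" "finite V" "\<Union>V = topspace T" using finite_subcover by blast
  define cell where "cell c = {y \<in> topspace T. \<forall>f\<in>F. act f y \<in> c f}" for c :: "'a \<Rightarrow> 'y set"
  show ?thesis
  proof (rule finite_refinement(1)[OF _ _ _ Union_join_cover_subset])
    show "finite (cell ` (F \<rightarrow>\<^sub>E V))" using F V by (intro finite_imageI finite_PiE) auto
    show "topspace T \<subseteq> \<Union>(cell ` (F \<rightarrow>\<^sub>E V))"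
    proof
      fix y assume y: "y \<in> topspace T"
      then have "\<forall>f\<in>F. \<exists>v\<in>V. act f y \<in> v" using act_closed F V by blast
      then obtain c where "\<forall>f\<in>F. c f \<in> V \<and> act f y \<in> c f" by metis
      then have "restrict c F \<in> F \<rightarrow>\<^sub>E V" "y \<in> cell (restrict c F)" using y by (auto simp: cell_def)
      then show "y \<in> \<Union>(cell ` (F \<rightarrow>\<^sub>E V))" by blast
    qed
    fix w assume "w \<in> cell ` (F \<rightarrow>\<^sub>E V)"
    then obtain c where "c \<in> F \<rightarrow>\<^sub>E V" "w = cell c" by blast
    moreover from this have "c \<in> F \<rightarrow> U" using V(1) by auto
    ultimately have "w \<in> join_cover T act U F" unfolding cell_def by (blast intro: join_coverI)
    then show "\<exists>u\<in>join_cover T act U F. w \<subseteq> u" by blast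
  qed
qed

abbreviation join_number :: "'a set \<Rightarrow> nat" where
  "join_number F \<equiv> cover_number T (join_cover T act U F)"

lemma minimal_subcover:
  assumes "finite F" "F \<subseteq> carrier G"
  obtains V where "V \<subseteq> join_cover T act U F" "finite V" "card V = join_number F" "\<Union>V = topspace T"
  using join_cover_finite_subcover[OF assms] cover_number_attained by metis

lemma join_number_pos:
  assumes "finite F" "F \<subseteq> carrier G" shows "0 < join_number F"
  using join_cover_finite_subcover[OF assms] cover_number_pos nonempty
  by metis

text \<open>The intersections of a member of \<open>U\<^sup>E\<close> with a member of \<open>U\<^sup>F\<close> refine \<open>U\<^bsup>E \<union> F\<^esup>\<close>. They need not
  belong to it, since the two choice functions may differ on \<open>E \<inter> F\<close>; this is harmless because a
  refinement is enough.\<close>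

lemma join_number_Un_le:
  assumes E: "finite E" "E \<subseteq> carrier G" and F: "finite F" "F \<subseteq> carrier G"
  shows "join_number (E \<union> F) \<le> join_number E * join_number F"
proof -
  obtain V where V: "V \<subseteq> join_cover T act U E" "finite V" "card V = join_number E" "\<Union>V = topspace T"
    using minimal_subcover[OF E] .
  obtain W where W: "W \<subseteq> join_cover T act U F" "finite W" "card W = join_number F" "\<Union>W = topspace T"
    using minimal_subcover[OF F] .
  define I where "I = (\<lambda>(v, w). v \<inter> w) ` (V \<times> W)"
  have "join_number (E \<union> F) \<le> card I"
  proof (rule finite_refinement(2)[OF _ _ _ Union_join_cover_subset])
    show "finite I" using V W by (auto simp: I_def)
    show "topspace T \<subseteq> \<Union>I"
    proof
      fix y assume "y \<in> topspace T"
      then obtain v w where "v \<in> V" "y \<in> v" "w \<in> W" "y \<in> w" using V(4) W(4) by blast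
      then show "y \<in> \<Union>I" by (auto simp: I_def)
    qed
    fix i assume "i \<in> I"
    then obtain v w where i: "i = v \<inter> w" "v \<in> V" "w \<in> W" by (auto simp: I_def)
    obtain c where c: "c \<in> E \<rightarrow> U" "v = {y \<in> topspace T. \<forall>f\<in>E. act f y \<in> c f}"
      using i V(1) by (auto simp: join_cover_def)
    obtain d where d: "d \<in> F \<rightarrow> U" "w = {y \<in> topspace T. \<forall>f\<in>F. act f y \<in> d f}"
      using i W(1) by (auto simp: join_cover_def)
    let ?cd = "\<lambda>f. if f \<in> E then c f else d f"
    have "?cd \<in> E \<union> F \<rightarrow> U" using c(1) d(1) by auto
    then have "{y \<in> topspace T. \<forall>f\<in>E \<union> F. act f y \<in> ?cd f} \<in> join_cover T act U (E \<union> F)"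
      by (rule join_coverI)
    moreover have "i \<subseteq> {y \<in> topspace T. \<forall>f\<in>E \<union> F. act f y \<in> ?cd f}" using i c(2) d(2) by auto
    ultimately show "\<exists>u\<in>join_cover T act U (E \<union> F). i \<subseteq> u" by blast
  qed
  also have "\<dots> \<le> card (V \<times> W)" unfolding I_def using V W by (intro card_image_le) auto
  finally show ?thesis using V W by (simp add: card_cartesian_product)
qed

text \<open>The preimage under \<open>g\<close> of a subcover of \<open>U\<^sup>F\<close> is a subcover of \<open>U\<^bsup>Fg\<^esup>\<close>, because
  \<open>act (f \<otimes> g) = act f \<circ> act g\<close>.\<close>

lemma join_number_r_coset_le:
  assumes F: "finite F" "F \<subseteq> carrier G" and g: "g \<in> carrier G"
  shows "join_number (F #> g) \<le> join_number F"
proof -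
  obtain V where V: "V \<subseteq> join_cover T act U F" "finite V" "card V = join_number F" "\<Union>V = topspace T"
    using minimal_subcover[OF F] .
  define pre where "pre v = {y \<in> topspace T. act g y \<in> v}" for v
  have "join_number (F #> g) \<le> card (pre ` V)"
  proof (rule finite_refinement(2)[OF _ _ _ Union_join_cover_subset])
    show "finite (pre ` V)" using V by simp
    show "topspace T \<subseteq> \<Union>(pre ` V)" using V(4) act_closed[OF g] by (auto simp: pre_def)
    fix w assume "w \<in> pre ` V"
    then obtain c where c: "c \<in> F \<rightarrow> U" "w = pre {y \<in> topspace T. \<forall>f\<in>F. act f y \<in> c f}"
      using V(1) by (auto simp: join_cover_def)
    let ?c = "\<lambda>k. c (k \<otimes> inv g)"
    have cancel: "f \<otimes> g \<otimes> inv g = f" if "f \<in> F" for f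
      using that F g by (auto simp: m_assoc subset_iff)
    have "?c \<in> (F #> g) \<rightarrow> U" using c(1) cancel by (auto simp: r_coset_def)
    then have "{y \<in> topspace T. \<forall>k\<in>(F #> g). act k y \<in> ?c k} \<in> join_cover T act U (F #> g)"
      by (rule join_coverI)
    moreover have "w \<subseteq> {y \<in> topspace T. \<forall>k\<in>(F #> g). act k y \<in> ?c k}"
      using F g by (auto simp: c(2) pre_def r_coset_def cancel act_mult subset_iff)
    ultimately show "\<exists>u\<in>join_cover T act U (F #> g). w \<subseteq> u" by blast
  qed
  also have "\<dots> \<le> join_number F" using card_image_le[OF V(2), of pre] V(3) by simp
  finally show ?thesis .
qed

lemma join_number_empty: "join_number {} = 1"
proof -
  have "join_number {} \<le> card {topspace T}"
    by (rule finite_refinement(2)[OF _ _ _ Union_join_cover_subset]) (auto simp: join_cover_def)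
  then show ?thesis using join_number_pos[of "{}"] by simp
qed

lemma right_invariant_subadditive_ln_join_number:
  "right_invariant_subadditive G (\<lambda>F. ln (real (join_number F)))"
proof
  fix B C assume B: "finite B" "B \<subseteq> carrier G" and C: "finite C" "C \<subseteq> carrier G"
  have pos: "0 < join_number B" "0 < join_number C" "0 < join_number (B \<union> C)"
    using join_number_pos B C by auto
  have "ln (real (join_number (B \<union> C))) \<le> ln (real (join_number B * join_number C))"
    using join_number_Un_le[OF B C] pos by (intro ln_mono of_nat_mono) auto
  then show "ln (real (join_number (B \<union> C))) \<le> ln (real (join_number B)) + ln (real (join_number C))"
    using pos by (simp add: ln_mult)
next
  fix B g assume B: "finite B" "B \<subseteq> carrier G" and g: "g \<in> carrier G"
  have "0 < join_number (B #> g)" using B g by (intro join_number_pos) (auto simp: r_coset_def)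
  then show "ln (real (join_number (B #> g))) \<le> ln (real (join_number B))"
    using join_number_r_coset_le[OF B g] by (intro ln_mono) auto
next
  fix B assume "finite B" "B \<subseteq> carrier G"
  from join_number_pos[OF this] show "0 \<le> ln (real (join_number B))" by (intro ln_ge_zero) auto
qed (simp add: join_number_empty)

text \<open>The definite description in the definition of the entropy of a cover denotes an actual limit. The
  given Folner sequence is what makes the described number unique.\<close>

theorem cover_entropy_tendsto:
  assumes "folner_seq G F"
  shows "(\<lambda>n. ln (real (join_number (F n))) / card (F n)) \<longlonglongrightarrow> cover_entropy G T act U"
proof -
  let ?Q = "\<lambda>L. \<forall>F. folner_seq G F \<longrightarrow> (\<lambda>n. ln (real (join_number (F n))) / card (F n)) \<longlonglongrightarrow> L"
  obtain L where L: "?Q L"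
    using right_invariant_subadditive.ornstein_weiss[OF right_invariant_subadditive_ln_join_number]
    by blast
  have "?Q (THE L. ?Q L)"
  proof (rule theI[of ?Q, OF L])
    fix L' assume "?Q L'"
    then have "(\<lambda>n. ln (real (join_number (F n))) / card (F n)) \<longlonglongrightarrow> L'" using assms by blast
    moreover have "(\<lambda>n. ln (real (join_number (F n))) / card (F n)) \<longlonglongrightarrow> L" using L assms by blast
    ultimately show "L' = L" by (rule LIMSEQ_unique)
  qed
  moreover have "cover_entropy G T act U = (THE L. ?Q L)"
    by (simp add: cover_entropy_def)
  ultimately show ?thesis using assms by simp
qed

end

section \<open>Pattern counts of a symbolic element\<close>

lemma openin_full_shift_cylinder:
  assumes "finite K" "K \<subseteq> carrier G"
  shows "openin (full_shift G A) {z \<in> topspace (full_shift G A). \<forall>k\<in>K. z k = y k}"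
proof -
  have "{z \<in> topspace (full_shift G A). \<forall>k\<in>K. z k = y k} =
      (\<Pi>\<^sub>E g\<in>carrier G. if g \<in> K then A \<inter> {y g} else A)" (is "_ = ?P")
    using assms(2) unfolding full_shift_def topspace_product_topology topspace_discrete_topology
    by (auto simp: PiE_iff extensional_def split: if_splits)
  moreover have "openin (full_shift G A) ?P"
    unfolding full_shift_def
    by (rule product_topology_basis)
      (auto intro: finite_subset[OF _ assms(1)])
  ultimately show ?thesis by simp
qed

lemma openin_full_shiftD:
  assumes "openin (full_shift G A) W" "y \<in> W"
  shows "\<exists>K. finite K \<and> K \<subseteq> carrier G \<and>
    {z \<in> topspace (full_shift G A). \<forall>k\<in>K. z k = y k} \<subseteq> W"
proof -
  obtain V where V: "finite {g \<in> carrier G. V g \<noteq> A}" "y \<in> PiE (carrier G) V" "PiE (carrier G) V \<subseteq> W"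
    using assms unfolding full_shift_def openin_product_topology_alt by force
  have "{z \<in> topspace (full_shift G A). \<forall>k\<in>{g \<in> carrier G. V g \<noteq> A}. z k = y k} \<subseteq> PiE (carrier G) V"
  proof
    fix z assume z: "z \<in> {z \<in> topspace (full_shift G A). \<forall>k\<in>{g \<in> carrier G. V g \<noteq> A}. z k = y k}"
    show "z \<in> PiE (carrier G) V"
    proof (rule PiE_I)
      fix g assume g: "g \<in> carrier G"
      show "z g \<in> V g"
      proof (cases "V g = A")
        case True then show ?thesis using z g by (auto simp: full_shift_def)
      next
        case False then show ?thesis using z g V(2) by (auto simp: PiE_iff)
      qed
    qed (use z in \<open>auto simp: full_shift_def PiE_iff extensional_def\<close>)
  qed
  with V show ?thesis by (intro exI[of _ "{g \<in> carrier G. V g \<noteq> A}"]) auto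
qed

locale symbolic_element = group +
  fixes A :: "'c set" and x :: "'a \<Rightarrow> 'c"
  assumes finite_alphabet: "finite A" and x_in: "x \<in> topspace (full_shift G A)"
begin

abbreviation Y :: "('a \<Rightarrow> 'c) set" where "Y \<equiv> orbit_closure G A x"

abbreviation T :: "('a \<Rightarrow> 'c) topology" where "T \<equiv> subtopology (full_shift G A) Y"

definition patterns :: "'a set \<Rightarrow> ('a \<Rightarrow> 'c) set" where
  "patterns E = (\<lambda>g. \<lambda>k\<in>E. x (k \<otimes> g)) ` carrier G"

lemma x_letter: "g \<in> carrier G \<Longrightarrow> x g \<in> A"
  using x_in by (auto simp: full_shift_def)

lemma topspace_orbit_closure: "topspace T = Y"
  by (auto simp: orbit_closure_def closure_of_def)

lemma compact_orbit_closure: "compact_space T"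
proof -
  have "compact_space (full_shift G A)"
    using finite_alphabet by (simp add: full_shift_def compact_space_product_topology compact_space_discrete_topology)
  moreover have "closedin (full_shift G A) Y" by (simp add: orbit_closure_def)
  ultimately show ?thesis
    by (intro compact_space_subtopology closedin_compact_space)
qed

text \<open>Basic neighbourhoods in the full shift are cylinders over finite sets, so a point is in the orbit
  closure exactly when all its finite patterns occur in \<open>x\<close>. This reduces the topology of the orbit
  closure to combinatorics of patterns.\<close>

lemma mem_orbit_closure_iff:
  "y \<in> Y \<longleftrightarrow> y \<in> topspace (full_shift G A) \<and>
    (\<forall>K. finite K \<and> K \<subseteq> carrier G \<longrightarrow> restrict y K \<in> patterns K)"
proof -
  have restr: "restrict y K \<in> patterns K \<longleftrightarrow> (\<exists>g\<in>carrier G. \<forall>k\<in>K. shift G g x k = y k)"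
    if "K \<subseteq> carrier G" for K
  proof -
    have "restrict y K = (\<lambda>k\<in>K. x (k \<otimes> g)) \<longleftrightarrow> (\<forall>k\<in>K. shift G g x k = y k)" for g
    proof
      assume eq: "restrict y K = (\<lambda>k\<in>K. x (k \<otimes> g))"
      show "\<forall>k\<in>K. shift G g x k = y k"
      proof
        fix k assume "k \<in> K"
        with fun_cong[OF eq, of k] that show "shift G g x k = y k" by (auto simp: shift_def)
      qed
    next
      assume eq: "\<forall>k\<in>K. shift G g x k = y k"
      show "restrict y K = (\<lambda>k\<in>K. x (k \<otimes> g))"
        using eq that by (intro restrict_ext) (simp add: shift_def subset_iff)
    qed
    then show ?thesis by (simp add: patterns_def image_iff)
  qed
  have orb: "shift G g x \<in> topspace (full_shift G A)" if "g \<in> carrier G" for g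
    using that x_letter by (auto simp: shift_def full_shift_def)
  show ?thesis
  proof (intro iffI conjI allI impI; (elim conjE)?)
    assume y: "y \<in> Y"
    then show yt: "y \<in> topspace (full_shift G A)" by (auto simp: orbit_closure_def closure_of_def)
    fix K assume K: "finite K" "K \<subseteq> carrier G"
    let ?T = "{z \<in> topspace (full_shift G A). \<forall>k\<in>K. z k = y k}"
    have "openin (full_shift G A) ?T" "y \<in> ?T"
      using openin_full_shift_cylinder[OF K] yt by auto
    moreover have "\<forall>W. y \<in> W \<and> openin (full_shift G A) W \<longrightarrow>
        (\<exists>z. z \<in> (\<lambda>g. shift G g x) ` carrier G \<and> z \<in> W)"
      using y unfolding orbit_closure_def in_closure_of by (rule conjunct2)
    ultimately have "\<exists>z. z \<in> (\<lambda>g. shift G g x) ` carrier G \<and> z \<in> ?T"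
      by (metis (no_types, lifting))
    then show "restrict y K \<in> patterns K"
      unfolding restr[OF K(2)] by auto
  next
    assume yt: "y \<in> topspace (full_shift G A)"
      and pat: "\<forall>K. finite K \<and> K \<subseteq> carrier G \<longrightarrow> restrict y K \<in> patterns K"
    have "\<exists>z. z \<in> (\<lambda>h. shift G h x) ` carrier G \<and> z \<in> W"
      if W: "y \<in> W" "openin (full_shift G A) W" for W
    proof -
      obtain K where K: "finite K" "K \<subseteq> carrier G"
        "{z \<in> topspace (full_shift G A). \<forall>k\<in>K. z k = y k} \<subseteq> W"
        using openin_full_shiftD[OF W(2,1)] by blast
      obtain g where "g \<in> carrier G" "\<forall>k\<in>K. shift G g x k = y k"
        using pat K(1,2) restr[OF K(2)] by blast
      then show ?thesis using orb K(3) by blast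
    qed
    then show "y \<in> Y" using yt unfolding orbit_closure_def in_closure_of by blast
  qed
qed

lemma shift_orbit: "g \<in> carrier G \<Longrightarrow> shift G g x \<in> Y"
proof -
  assume g: "g \<in> carrier G"
  have "restrict (shift G g x) K \<in> patterns K" if "K \<subseteq> carrier G" for K
  proof -
    have "restrict (shift G g x) K = (\<lambda>k\<in>K. x (k \<otimes> g))"
      using that by (intro restrict_ext) (auto simp: shift_def)
    then show ?thesis using g by (auto simp: patterns_def)
  qed
  then show ?thesis
    using g x_letter by (auto simp: mem_orbit_closure_iff shift_def full_shift_def)
qed

lemma letter: "\<lbrakk>y \<in> Y; g \<in> carrier G\<rbrakk> \<Longrightarrow> y g \<in> A"
  by (auto simp: mem_orbit_closure_iff full_shift_def)

lemma restrict_in_patterns: "\<lbrakk>y \<in> Y; finite K; K \<subseteq> carrier G\<rbrakk> \<Longrightarrow> restrict y K \<in> patterns K"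
  by (simp add: mem_orbit_closure_iff)

lemma pattern_occurs:
  assumes "w \<in> patterns E" "E \<subseteq> carrier G"
  shows "\<exists>y\<in>Y. restrict y E = w"
proof -
  obtain g where g: "g \<in> carrier G" "w = (\<lambda>k\<in>E. x (k \<otimes> g))" using assms by (auto simp: patterns_def)
  have "restrict (shift G g x) E = w"
    unfolding g(2) using assms(2) by (intro restrict_ext) (auto simp: shift_def)
  then show ?thesis using shift_orbit[OF g(1)] by blast
qed

lemma shift_closed:
  assumes y: "y \<in> Y" and g: "g \<in> carrier G"
  shows "shift G g y \<in> Y"
  unfolding mem_orbit_closure_iff
proof (intro conjI allI impI; (elim conjE)?)
  show "shift G g y \<in> topspace (full_shift G A)"
    using letter[OF y] g by (auto simp: shift_def full_shift_def)
  fix K assume K: "finite K" "K \<subseteq> carrier G"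
  have Kg: "finite (K #> g)" "K #> g \<subseteq> carrier G" using K g by (auto simp: r_coset_def)
  obtain h where h: "h \<in> carrier G" "restrict y (K #> g) = (\<lambda>k\<in>K #> g. x (k \<otimes> h))"
    using restrict_in_patterns[OF y Kg] by (auto simp: patterns_def)
  have "restrict (shift G g y) K = (\<lambda>k\<in>K. x (k \<otimes> (g \<otimes> h)))"
  proof (rule restrict_ext)
    fix k assume k: "k \<in> K"
    then have "k \<otimes> g \<in> K #> g" by (auto simp: r_coset_def)
    then have "y (k \<otimes> g) = x (k \<otimes> g \<otimes> h)" using fun_cong[OF h(2), of "k \<otimes> g"] by simp
    then show "shift G g y k = x (k \<otimes> (g \<otimes> h))"
      using k K g h(1) by (auto simp: shift_def m_assoc subset_iff)
  qed
  then show "restrict (shift G g y) K \<in> patterns K" using g h(1) by (auto simp: patterns_def)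
qed

lemma patterns_subset: "E \<subseteq> carrier G \<Longrightarrow> patterns E \<subseteq> E \<rightarrow>\<^sub>E A"
  using x_letter by (auto simp: patterns_def subset_iff)

lemma finite_patterns: "\<lbrakk>finite E; E \<subseteq> carrier G\<rbrakk> \<Longrightarrow> finite (patterns E)"
  using finite_subset[OF patterns_subset] finite_PiE[of E "\<lambda>_. A"] finite_alphabet by blast

lemma card_patterns_pos: "\<lbrakk>finite E; E \<subseteq> carrier G\<rbrakk> \<Longrightarrow> 0 < card (patterns E)"
  using finite_patterns by (auto simp: card_gt_0_iff patterns_def)

text \<open>A pattern on \<open>B\<close> is glued from a pattern on \<open>E\<close> and arbitrary letters on \<open>D\<close>.\<close>

lemma card_patterns_le:
  assumes E: "finite E" "E \<subseteq> carrier G" and D: "finite D" "D \<subseteq> carrier G" and B: "B \<subseteq> E \<union> D"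
  shows "card (patterns B) \<le> card (patterns E) * card A ^ card D"
proof -
  let ?glue = "\<lambda>(v, w). \<lambda>k\<in>B. if k \<in> E then v k else w k"
  have "patterns B \<subseteq> ?glue ` (patterns E \<times> patterns D)"
  proof
    fix u assume "u \<in> patterns B"
    then obtain g where g: "g \<in> carrier G" "u = (\<lambda>k\<in>B. x (k \<otimes> g))" by (auto simp: patterns_def)
    have "u = ?glue (\<lambda>k\<in>E. x (k \<otimes> g), \<lambda>k\<in>D. x (k \<otimes> g))"
      using g(2) B by (auto simp: fun_eq_iff)
    then show "u \<in> ?glue ` (patterns E \<times> patterns D)"
      using g(1) unfolding patterns_def by blast
  qed
  then have "card (patterns B) \<le> card (patterns E \<times> patterns D)"
    using finite_patterns E D by (intro surj_card_le) auto
  also have "\<dots> \<le> card (patterns E) * card (D \<rightarrow>\<^sub>E A)"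
    using patterns_subset[OF D(2)] finite_PiE[of D "\<lambda>_. A"] D(1) finite_alphabet
    by (auto simp: card_cartesian_product intro!: mult_le_mono2 card_mono)
  finally show ?thesis using D(1) by (simp add: card_PiE)
qed

text \<open>The symbolic form of the Lebesgue number lemma: one finite window \<open>K\<close> is fine enough for all points
  of the orbit closure. Finitely many cylinders that are contained in members of \<open>U\<close> cover the orbit
  closure, and \<open>K\<close> is the union of their windows.\<close>

lemma uniform_window:
  assumes U: "open_cover T U"
  shows "\<exists>K. finite K \<and> K \<subseteq> carrier G \<and> (\<forall>y\<in>Y. \<exists>u\<in>U. {z \<in> Y. \<forall>k\<in>K. z k = y k} \<subseteq> u)"
proof -
  define cyl where "cyl = (\<lambda>(K, y :: 'a \<Rightarrow> 'c). {z \<in> Y. \<forall>k\<in>K. z k = y k})"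
  define I where "I = {(K, y). finite K \<and> K \<subseteq> carrier G \<and> (\<exists>u\<in>U. cyl (K, y) \<subseteq> u)}"
  have Y_sub: "Y \<subseteq> topspace (full_shift G A)" by (auto simp: mem_orbit_closure_iff)
  have "openin T C" if C: "C \<in> cyl ` I" for C
  proof -
    obtain K y where K: "finite K" "K \<subseteq> carrier G" and "C = cyl (K, y)"
      using C by (auto simp: I_def)
    then have "C = {z \<in> topspace (full_shift G A). \<forall>k\<in>K. z k = y k} \<inter> Y"
      using Y_sub by (auto simp: cyl_def)
    then show ?thesis using openin_full_shift_cylinder[OF K] unfolding openin_subtopology by blast
  qed
  moreover have "topspace T \<subseteq> \<Union>(cyl ` I)"
    unfolding topspace_orbit_closure
  proof
    fix y assume y: "y \<in> Y"
    have "\<Union>U = Y" using U unfolding open_cover_def topspace_orbit_closure by (rule conjunct2)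
    then obtain u where u: "u \<in> U" "y \<in> u" using y by blast
    then have "openin T u" using U unfolding open_cover_def by blast
    then obtain W where W: "openin (full_shift G A) W" "u = W \<inter> Y"
      unfolding openin_subtopology by blast
    have "y \<in> W" using u(2) W(2) by blast
    from openin_full_shiftD[OF W(1) this] obtain K where K: "finite K" "K \<subseteq> carrier G"
      "{z \<in> topspace (full_shift G A). \<forall>k\<in>K. z k = y k} \<subseteq> W"
      by blast
    then have "cyl (K, y) \<subseteq> u" using W(2) Y_sub by (auto simp: cyl_def)
    then have "(K, y) \<in> I" using K u(1) by (auto simp: I_def)
    moreover have "y \<in> cyl (K, y)" using y by (simp add: cyl_def)
    ultimately show "y \<in> \<Union>(cyl ` I)" by blast
  qed
  ultimately obtain \<F> where \<F>: "finite \<F>" "\<F> \<subseteq> cyl ` I" "topspace T \<subseteq> \<Union>\<F>"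
    using compact_orbit_closure unfolding compact_space_alt by meson
  obtain J where J: "J \<subseteq> I" "finite J" "\<F> = cyl ` J"
    using finite_subset_image[OF \<F>(1,2)] by blast
  let ?K = "\<Union>(fst ` J)"
  have "\<exists>u\<in>U. {y \<in> Y. \<forall>k\<in>?K. y k = z k} \<subseteq> u" if z: "z \<in> Y" for z
  proof -
    obtain j where j: "j \<in> J" "z \<in> cyl j"
      using \<F>(3) J(3) z unfolding topspace_orbit_closure by blast
    obtain K y where Ky: "j = (K, y)" by (cases j)
    obtain u where u: "u \<in> U" "cyl (K, y) \<subseteq> u" using J(1) j(1) by (auto simp: I_def Ky)
    have "K \<subseteq> ?K" using j(1) Ky by force
    then have "{y \<in> Y. \<forall>k\<in>?K. y k = z k} \<subseteq> cyl (K, y)"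
      using j(2) by (auto simp: cyl_def Ky subset_iff)
    then show ?thesis using u by blast
  qed
  moreover have "finite ?K" "?K \<subseteq> carrier G"
    using J(1,2) by (auto simp: I_def subset_iff)
  ultimately show ?thesis by blast
qed

lemma action_cover_orbit_closure:
  assumes U: "open_cover T U"
  shows "action_cover G T (shift G) U"
proof
  show "topspace T \<noteq> {}" using shift_orbit[OF one_closed] unfolding topspace_orbit_closure by blast
  fix g y assume gy: "g \<in> carrier G" "y \<in> topspace T"
  then show "shift G g y \<in> topspace T"
    unfolding topspace_orbit_closure by (intro shift_closed)
  fix k assume "k \<in> carrier G"
  with gy show "shift G (g \<otimes> k) y = shift G g (shift G k y)"
    by (auto simp: shift_def fun_eq_iff m_assoc)
next
  obtain V where "finite V" "V \<subseteq> U" "topspace T \<subseteq> \<Union>V"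
    using U compact_orbit_closure unfolding compact_space_alt open_cover_def by (metis order_refl)
  moreover have "\<Union>V \<subseteq> topspace T" using U \<open>V \<subseteq> U\<close> by (auto simp: open_cover_def)
  ultimately show "\<exists>V\<subseteq>U. finite V \<and> \<Union>V = topspace T" by blast
qed

text \<open>If the pattern on \<open>K\<close> decides a member of \<open>U\<close>, then the pattern of \<open>y\<close> on \<open>K F\<close> contains the
  patterns on \<open>K\<close> of all \<open>shift G f y\<close> with \<open>f \<in> F\<close>, and so decides a member of \<open>U\<^sup>F\<close>. For the
  cover by letters \<open>K = {\<one>}\<close> suffices, and the bound is sharp.\<close>

lemma cover_number_join_le:
  assumes U: "open_cover T U"
    and K: "finite K" "K \<subseteq> carrier G" "\<forall>y\<in>Y. \<exists>u\<in>U. {z \<in> Y. \<forall>k\<in>K. z k = y k} \<subseteq> u"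
    and F: "finite F" "F \<subseteq> carrier G"
  shows "cover_number T (join_cover T (shift G) U F) \<le> card (patterns (K <#> F))"
proof -
  have KF: "finite (K <#> F)" "K <#> F \<subseteq> carrier G"
    using K F by (auto simp: finite_set_mult set_mult_def)
  let ?Z = "\<lambda>w. {y \<in> Y. restrict y (K <#> F) = w}"
  have "cover_number T (join_cover T (shift G) U F) \<le> card (?Z ` patterns (K <#> F))"
  proof (rule finite_refinement(2)[OF _ _ _ Union_join_cover_subset])
    show "finite (?Z ` patterns (K <#> F))" using finite_patterns[OF KF] by simp
    show "topspace T \<subseteq> \<Union>(?Z ` patterns (K <#> F))"
      using restrict_in_patterns[OF _ KF] by (auto simp: topspace_orbit_closure)
    fix Z assume "Z \<in> ?Z ` patterns (K <#> F)"
    then obtain w where w: "w \<in> patterns (K <#> F)" "Z = ?Z w" by blast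
    obtain y0 where y0: "y0 \<in> Y" "restrict y0 (K <#> F) = w" using pattern_occurs[OF w(1) KF(2)] by blast
    have "\<forall>f\<in>F. \<exists>u\<in>U. {z \<in> Y. \<forall>k\<in>K. z k = shift G f y0 k} \<subseteq> u"
      using K(3) shift_closed[OF y0(1)] F(2) by blast
    then have "\<forall>f\<in>F. \<exists>u. u \<in> U \<and> {z \<in> Y. \<forall>k\<in>K. z k = shift G f y0 k} \<subseteq> u" by blast
    from bchoice[OF this]
    obtain c where c: "\<forall>f\<in>F. c f \<in> U \<and> {z \<in> Y. \<forall>k\<in>K. z k = shift G f y0 k} \<subseteq> c f" by blast
    have "Z \<subseteq> {y \<in> topspace T. \<forall>f\<in>F. shift G f y \<in> c f}"
    proof (safe, unfold topspace_orbit_closure)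
      fix y assume "y \<in> Z"
      then have y: "y \<in> Y" "restrict y (K <#> F) = restrict y0 (K <#> F)" using w(2) y0(2) by auto
      then show "y \<in> Y" by simp
      fix f assume f: "f \<in> F"
      have "shift G f y k = shift G f y0 k" if "k \<in> K" for k
      proof -
        have "k \<otimes> f \<in> K <#> F" using that f by (auto simp: set_mult_def)
        then have "y (k \<otimes> f) = y0 (k \<otimes> f)" using fun_cong[OF y(2), of "k \<otimes> f"] by simp
        then show ?thesis using that K(2) by (auto simp: shift_def)
      qed
      moreover have "shift G f y \<in> Y" using shift_closed[OF y(1)] f F(2) by blast
      ultimately show "shift G f y \<in> c f" using c f by blast
    qed
    moreover have "{y \<in> topspace T. \<forall>f\<in>F. shift G f y \<in> c f} \<in> join_cover T (shift G) U F"
      using c by (intro join_coverI) auto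
    ultimately show "\<exists>u\<in>join_cover T (shift G) U F. Z \<subseteq> u" by blast
  qed
  also have "\<dots> \<le> card (patterns (K <#> F))" using finite_patterns[OF KF] by (rule card_image_le)
  finally show ?thesis .
qed

definition letter_cover :: "('a \<Rightarrow> 'c) set set" where
  "letter_cover = (\<lambda>a. {y \<in> Y. y \<one> = a}) ` A"

lemma open_letter_cover: "open_cover T letter_cover"
  unfolding open_cover_def
proof (intro conjI ballI)
  fix u assume "u \<in> letter_cover"
  then obtain a where "u = {y \<in> Y. y \<one> = a}" by (auto simp: letter_cover_def)
  then have "u = {z \<in> topspace (full_shift G A). \<forall>k\<in>{\<one>}. z k = (\<lambda>_. a) k} \<inter> Y"
    by (auto simp: mem_orbit_closure_iff)
  then show "openin T u"
    using openin_full_shift_cylinder[of "{\<one>}" G A "\<lambda>_. a"] unfolding openin_subtopology by blast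
next
  show "\<Union>letter_cover = topspace T"
    using letter unfolding topspace_orbit_closure by (auto simp: letter_cover_def)
qed

text \<open>The pattern on \<open>F\<close> is constant on each member of the join of the letter cover, and every pattern
  occurs in the orbit closure; so a subcover has at least as many members as there are patterns.\<close>

lemma card_patterns_le_letter_cover:
  assumes F: "finite F" "F \<subseteq> carrier G"
  shows "card (patterns F) \<le> cover_number T (join_cover T (shift G) letter_cover F)"
proof -
  interpret action_cover G T "shift G" letter_cover
    by (rule action_cover_orbit_closure[OF open_letter_cover])
  obtain V where V: "V \<subseteq> join_cover T (shift G) letter_cover F" "finite V"
    "card V = join_number F" "\<Union>V = topspace T"
    using minimal_subcover[OF F] .
  have same: "restrict y F = restrict z F" if vyz: "v \<in> V" "y \<in> v" "z \<in> v" for v y z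
  proof -
    obtain c where c: "c \<in> F \<rightarrow> letter_cover" "v = {y \<in> topspace T. \<forall>f\<in>F. shift G f y \<in> c f}"
      using subsetD[OF V(1) vyz(1)] by (auto simp only: join_cover_def)
    show ?thesis
    proof (rule restrict_ext)
      fix f assume f: "f \<in> F"
      then obtain a where "c f = {y \<in> Y. y \<one> = a}" using c(1) by (auto simp: letter_cover_def Pi_iff)
      moreover have "shift G f y \<in> c f" "shift G f z \<in> c f" using vyz(2,3) c(2) f by auto
      ultimately have "shift G f y \<one> = shift G f z \<one>" by auto
      then show "y f = z f" using f F(2) by (auto simp: shift_def subset_iff)
    qed
  qed
  let ?pat = "\<lambda>v. restrict (SOME y. y \<in> v) F"
  have "patterns F \<subseteq> ?pat ` V"
  proof
    fix w assume "w \<in> patterns F"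
    then obtain y where y: "y \<in> Y" "restrict y F = w" using pattern_occurs F(2) by blast
    then obtain v where v: "v \<in> V" "y \<in> v" using V(4) unfolding topspace_orbit_closure by blast
    then have "(SOME y. y \<in> v) \<in> v" by (metis someI)
    then have "?pat v = w" using same[OF v(1) _ v(2)] y(2) by simp
    then show "w \<in> ?pat ` V" using v(1) by blast
  qed
  then show ?thesis using V(2,3) by (metis surj_card_le)
qed

text \<open>The letter cover is generating: no open cover has larger entropy. The window \<open>K\<close> of another cover
  costs a factor of at most \<open>|A|\<^bsup>|K F - F|\<^esup>\<close>, which is subexponential in \<open>|F|\<close> along a Folner sequence.\<close>

theorem orbit_entropy_eq_pattern_growth:
  assumes "amenable G"
  shows "\<exists>L. orbit_entropy G A x = ereal L \<and>
    (\<forall>F. folner_seq G F \<longrightarrow> (\<lambda>n. ln (real (card (patterns (F n)))) / card (F n)) \<longlonglongrightarrow> L)"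
proof -
  define L where "L = cover_entropy G T (shift G) letter_cover"
  have lim: "(\<lambda>n. ln (real (card (patterns (F n)))) / card (F n)) \<longlonglongrightarrow> L" if "folner_seq G F" for F
  proof -
    have eq: "cover_number T (join_cover T (shift G) letter_cover (F n)) = card (patterns (F n))" for n
    proof (rule antisym)
      have F: "finite (F n)" "F n \<subseteq> carrier G" using that by (auto simp: folner_seq_def Fin_def)
      have "\<forall>y\<in>Y. \<exists>u\<in>letter_cover. {z \<in> Y. \<forall>k\<in>{\<one>}. z k = y k} \<subseteq> u"
        using letter by (auto simp: letter_cover_def)
      from cover_number_join_le[OF open_letter_cover _ _ this F]
      show "cover_number T (join_cover T (shift G) letter_cover (F n)) \<le> card (patterns (F n))"
        using lcos_mult_one[OF F(2)] by (simp add: l_coset_eq_set_mult)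
    qed (use that in \<open>auto intro!: card_patterns_le_letter_cover simp: folner_seq_def Fin_def\<close>)
    show ?thesis
      using action_cover.cover_entropy_tendsto[OF action_cover_orbit_closure[OF open_letter_cover] that]
      by (simp add: eq L_def)
  qed
  obtain F where F: "folner_seq G F" using assms by (auto simp: amenable_def)
  have Fn: "finite (F n)" "F n \<subseteq> carrier G" "0 < card (F n)" for n
    using F by (auto simp: folner_seq_def Fin_def card_gt_0_iff)
  have card_A: "0 < card A" using x_letter[OF one_closed] finite_alphabet by (auto simp: card_gt_0_iff)
  have upper: "cover_entropy G T (shift G) U \<le> L" if U: "open_cover T U" for U
  proof -
    let ?N = "\<lambda>F. cover_number T (join_cover T (shift G) U F)"
    interpret ac: action_cover G T "shift G" U by (rule action_cover_orbit_closure[OF U])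
    obtain K where K: "finite K" "K \<subseteq> carrier G" "\<forall>y\<in>Y. \<exists>u\<in>U. {z \<in> Y. \<forall>k\<in>K. z k = y k} \<subseteq> u"
      using uniform_window[OF U] by blast
    have "cover_entropy G T (shift G) U \<le> L + e" if "0 < e" for e
    proof (rule tendsto_le[OF _ tendsto_add[OF lim[OF F] tendsto_const] ac.cover_entropy_tendsto[OF F]])
      \<comment> \<open>The summand \<open>1\<close> keeps the denominator positive for a one-letter alphabet.\<close>
      let ?\<eta> = "e / (ln (card A) + 1)"
      have lnA: "0 \<le> ln (real (card A))" using card_A by simp
      then have "0 < ?\<eta>" using that by simp
      from folner_eventually_invariant[OF F K(1,2) this]
      show "\<forall>\<^sub>F n in sequentially. ln (real (?N (F n))) / card (F n)
          \<le> ln (real (card (patterns (F n)))) / card (F n) + e"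
      proof eventually_elim
        case (elim n)
        let ?D = "(K <#> F n) - F n"
        have D: "finite ?D" "?D \<subseteq> carrier G"
          using K Fn[of n] by (auto simp: finite_set_mult set_mult_def)
        have "?N (F n) \<le> card (patterns (K <#> F n))" by (rule cover_number_join_le[OF U K Fn(1,2)])
        also have "\<dots> \<le> card (patterns (F n)) * card A ^ card ?D"
          by (rule card_patterns_le[OF Fn(1,2) D]) auto
        finally have "real (?N (F n)) \<le> real (card (patterns (F n)) * card A ^ card ?D)"
          by (rule of_nat_mono)
        then have "ln (real (?N (F n))) \<le> ln (real (card (patterns (F n)) * card A ^ card ?D))"
          using ac.join_number_pos[OF Fn(1,2)[of n]] by (intro ln_mono) auto
        also have "\<dots> = ln (real (card (patterns (F n)))) + card ?D * ln (card A)"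
          using card_patterns_pos[OF Fn(1,2)[of n]] card_A by (simp add: ln_mult ln_realpow)
        also have "card ?D * ln (card A) \<le> ?\<eta> * card (F n) * (ln (card A) + 1)"
          using elim lnA by (intro mult_mono) auto
        also have "\<dots> = e * card (F n)" using lnA by (simp add: field_simps)
        finally show ?case using Fn(3)[of n] by (simp add: divide_simps algebra_simps)
      qed
    qed simp
    then show ?thesis by (rule field_le_epsilon)
  qed
  have "orbit_entropy G A x = ereal L"
    unfolding orbit_entropy_def top_entropy_def
  proof (rule antisym)
    show "(SUP U\<in>{U. open_cover T U}. ereal (cover_entropy G T (shift G) U)) \<le> ereal L"
      using upper by (intro SUP_least) auto
    show "ereal L \<le> (SUP U\<in>{U. open_cover T U}. ereal (cover_entropy G T (shift G) U))"
      unfolding L_def using open_letter_cover by (intro SUP_upper) auto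
  qed
  then show ?thesis using lim by blast
qed

end

section \<open>Continuity of the entropy\<close>

context group begin

text \<open>Smallness of the density of \<open>B\<close> is witnessed by one finite set \<open>K\<close>, and averaging transports it to
  every sufficiently invariant \<open>F\<close>. Each point of \<open>B\<close> in \<open>F g\<close> lies in \<open>|K|\<close> translates \<open>K c\<close>, all
  with \<open>c \<in> K\<^sup>-\<^sup>1 F g\<close>; each translate contains at most \<open>d |K|\<close> points of \<open>B\<close>, and there are at most
  \<open>2 |F|\<close> of them once \<open>|K\<^sup>-\<^sup>1 F - F| \<le> |F|\<close>.\<close>

lemma small_upper_banach_density:
  assumes F: "folner_seq G F" and small: "upper_banach_density G B < d" and d: "0 < d"
  shows "\<forall>\<^sub>F n in sequentially. \<forall>g\<in>carrier G. real (card (B \<inter> (F n #> g))) \<le> 2 * d * card (F n)"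
proof -
  let ?sup = "\<lambda>K. SUP g\<in>carrier G. real (card (B \<inter> (K #> g))) / real (card K)"
  have Fin_card: "finite K" "K \<subseteq> carrier G" "0 < card K" if "K \<in> Fin G" for K
    using that by (auto simp: Fin_def card_gt_0_iff)
  have ratio: "real (card (B \<inter> (K #> g))) / card K \<le> 1" if "K \<in> Fin G" "g \<in> carrier G" for K g
  proof -
    have "card (B \<inter> (K #> g)) \<le> card (K #> g)"
      using Fin_card[OF that(1)] by (intro card_mono) (auto simp: r_coset_def)
    then show ?thesis using Fin_card[OF that(1)] that(2) by (simp add: card_r_coset)
  qed
  have bdd: "bdd_above ((\<lambda>g. real (card (B \<inter> (K #> g))) / card K) ` carrier G)" if "K \<in> Fin G" for K
    using ratio[OF that] by (auto intro!: bdd_aboveI[of _ 1])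
  have "{\<one>} \<in> Fin G" by (simp add: Fin_def)
  then obtain K where K: "K \<in> Fin G" "?sup K < d"
    using cInf_lessD[of "?sup ` Fin G" d] small unfolding upper_banach_density_def by blast
  note Kf = Fin_card[OF K(1)]
  have dens: "real (card (B \<inter> (K #> c))) \<le> d * card K" if "c \<in> carrier G" for c
  proof -
    have "real (card (B \<inter> (K #> c))) / card K \<le> ?sup K"
      by (rule cSUP_upper[OF that bdd[OF K(1)]])
    then have "real (card (B \<inter> (K #> c))) / card K \<le> d" using K(2) by linarith
    then show ?thesis using Kf(3) by (simp add: divide_simps)
  qed
  have Ki: "finite (set_inv K)" "set_inv K \<subseteq> carrier G" using Kf by (auto simp: SET_INV_def)
  from folner_eventually_invariant[OF F Ki zero_less_one] show ?thesis
  proof eventually_elim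
    case (elim n)
    have Fn: "finite (F n)" "F n \<subseteq> carrier G" using F by (auto simp: folner_seq_def Fin_def)
    show ?case
    proof
      fix g assume g: "g \<in> carrier G"
      define C where "C = (F n \<union> (set_inv K <#> F n)) #> g"
      have KF: "F n \<union> (set_inv K <#> F n) \<subseteq> carrier G" "finite (F n \<union> (set_inv K <#> F n))"
        using Fn Ki by (auto simp: set_mult_def)
      have C: "finite C" "C \<subseteq> carrier G" using KF g by (auto simp: C_def r_coset_def)
      have "card C = card (F n) + card ((set_inv K <#> F n) - F n)"
        unfolding C_def card_r_coset[OF KF(1) g] using Fn Ki
        by (metis Diff_disjoint Un_Diff_cancel card_Un_disjoint finite_Diff finite_set_mult)
      then have cardC: "real (card C) \<le> 2 * card (F n)" using elim by simp
      have each: "card (B \<inter> (F n #> g)) \<le> card {c\<in>C. k \<otimes> c \<in> B}" if k: "k \<in> K" for k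
      proof (rule card_inj_on_le[of "\<lambda>b. inv k \<otimes> b"])
        have kG: "k \<in> carrier G" using k Kf by auto
        show "inj_on ((\<otimes>) (inv k)) (B \<inter> (F n #> g))"
          using kG Fn g by (auto intro!: inj_onI simp: r_coset_def subset_iff)
        show "(\<otimes>) (inv k) ` (B \<inter> (F n #> g)) \<subseteq> {c\<in>C. k \<otimes> c \<in> B}"
        proof safe
          fix b assume b: "b \<in> B" "b \<in> F n #> g"
          then obtain f where f: "f \<in> F n" "b = f \<otimes> g" by (auto simp: r_coset_def)
          then have fG: "f \<in> carrier G" using Fn by auto
          have "inv k \<otimes> f \<in> set_inv K <#> F n" using k f by (auto simp: set_mult_def SET_INV_def)
          moreover have "inv k \<otimes> b = (inv k \<otimes> f) \<otimes> g" using kG fG g by (simp add: f m_assoc)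
          ultimately show "inv k \<otimes> b \<in> C" unfolding C_def r_coset_def by blast
          have "k \<otimes> (inv k \<otimes> b) = b" using kG fG g by (simp add: f m_assoc[symmetric])
          then show "k \<otimes> (inv k \<otimes> b) \<in> B" using b by simp
        qed
        show "finite {c\<in>C. k \<otimes> c \<in> B}" using C by simp
      qed
      have "card K * card (B \<inter> (F n #> g)) \<le> (\<Sum>k\<in>K. card {c\<in>C. k \<otimes> c \<in> B})"
        using sum_mono[OF each, of K] by simp
      also have "\<dots> = (\<Sum>c\<in>C. card ((K #> c) \<inter> B))"
        using sum_card_translates_eq[OF Kf(1,2) C] by simp
      finally have "real (card K * card (B \<inter> (F n #> g))) \<le> (\<Sum>c\<in>C. real (card ((K #> c) \<inter> B)))"
        by (metis of_nat_le_iff of_nat_sum)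
      also have "\<dots> \<le> (\<Sum>c\<in>C. d * card K)"
        using dens C by (intro sum_mono) (auto simp: Int_commute)
      also have "\<dots> = card C * (d * card K)" by simp
      also have "\<dots> \<le> 2 * card (F n) * (d * card K)"
        using cardC d by (intro mult_right_mono) auto
      finally have "card K * real (card (B \<inter> (F n #> g))) \<le> card K * (2 * d * card (F n))"
        by (simp add: mult_ac)
      then show "real (card (B \<inter> (F n #> g))) \<le> 2 * d * card (F n)" using Kf(3) by simp
    qed
  qed
qed

end

text \<open>An exponential Markov estimate: weigh each word \<open>w\<close> by \<open>t\<close> to the power of its distance from \<open>v\<close>. In
  the ball the weights are at least \<open>t powr m\<close>, while the total weight is a product over the
  positions, with factors at most \<open>1 + |A| t\<close>.\<close>

lemma card_hamming_ball_le:
  fixes t m :: real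
  assumes F: "finite F" and A: "finite A" and t: "0 < t" "t \<le> 1"
  shows "card {w \<in> F \<rightarrow>\<^sub>E A. card {f\<in>F. w f \<noteq> v f} \<le> m} \<le> t powr (- m) * exp (card A * t * card F)"
proof -
  let ?B = "{w \<in> F \<rightarrow>\<^sub>E A. card {f\<in>F. w f \<noteq> v f} \<le> m}"
  let ?wt = "\<lambda>f a. if a = v f then 1 else t"
  have fin: "finite (F \<rightarrow>\<^sub>E A)" using F A by (intro finite_PiE) auto
  have wt: "(\<Prod>f\<in>F. ?wt f (w f)) = t ^ card {f\<in>F. w f \<noteq> v f}" for w
  proof -
    have "(\<Prod>f\<in>F. ?wt f (w f)) = (\<Prod>f\<in>{f\<in>F. w f \<noteq> v f}. t)"
      using F by (intro prod.mono_neutral_cong_right) auto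
    then show ?thesis by simp
  qed
  have "real (card ?B) = (\<Sum>w\<in>?B. 1)" by simp
  also have "\<dots> \<le> (\<Sum>w\<in>?B. t powr (- m) * (\<Prod>f\<in>F. ?wt f (w f)))"
  proof (rule sum_mono)
    fix w assume w: "w \<in> ?B"
    have "1 = t powr (- m) * t powr m" using t by (simp add: powr_minus)
    also have "\<dots> \<le> t powr (- m) * t powr real (card {f\<in>F. w f \<noteq> v f})"
      using w t by (intro mult_left_mono powr_mono') auto
    finally show "1 \<le> t powr (- m) * (\<Prod>f\<in>F. ?wt f (w f))"
      using t by (simp add: wt powr_realpow)
  qed
  also have "\<dots> \<le> (\<Sum>w\<in>F \<rightarrow>\<^sub>E A. t powr (- m) * (\<Prod>f\<in>F. ?wt f (w f)))"
    using fin t by (intro sum_mono2) (auto intro!: mult_nonneg_nonneg prod_nonneg)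
  also have "\<dots> = t powr (- m) * (\<Sum>w\<in>F \<rightarrow>\<^sub>E A. \<Prod>f\<in>F. ?wt f (w f))"
    by (rule sum_distrib_left[symmetric])
  also have "(\<Sum>w\<in>F \<rightarrow>\<^sub>E A. \<Prod>f\<in>F. ?wt f (w f)) = (\<Prod>f\<in>F. \<Sum>a\<in>A. ?wt f a)"
    by (rule prod_sum_PiE[symmetric]) (use F A in auto)
  also have "\<dots> \<le> (\<Prod>f\<in>F. exp (card A * t))"
  proof (intro prod_mono conjI)
    fix f assume "f \<in> F"
    show "0 \<le> (\<Sum>a\<in>A. ?wt f a)" using t by (intro sum_nonneg) auto
    have "(\<Sum>a\<in>A. ?wt f a) \<le> (\<Sum>a\<in>A. (if a = v f then 1 else 0) + t)"
      using t by (intro sum_mono) auto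
    also have "\<dots> \<le> 1 + card A * t" using A by (simp add: sum.distrib)
    also have "\<dots> \<le> exp (card A * t)" by (rule exp_ge_add_one_self)
    finally show "(\<Sum>a\<in>A. ?wt f a) \<le> exp (card A * t)" .
  qed
  also have "\<dots> = exp (card A * t * card F)" by (simp add: exp_of_nat_mult[symmetric] mult_ac)
  finally show ?thesis using t by (simp add: mult_left_mono)
qed

lemma card_patterns_perturb:
  fixes t m :: real
  assumes x: "symbolic_element G A x" and x': "symbolic_element G A x'"
    and F: "finite F" "F \<subseteq> carrier G" and t: "0 < t" "t \<le> 1"
    and near: "\<And>g. g \<in> carrier G \<Longrightarrow>
      card ({g \<in> carrier G. x g \<noteq> x' g} \<inter> (F #>\<^bsub>G\<^esub> g)) \<le> m"
  shows "card (symbolic_element.patterns G x' F)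
    \<le> card (symbolic_element.patterns G x F) * (t powr (- m) * exp (card A * t * card F))"
proof -
  interpret x: symbolic_element G A x by fact
  interpret x': symbolic_element G A x' by fact
  let ?ball = "\<lambda>v. {w \<in> F \<rightarrow>\<^sub>E A. card {f\<in>F. w f \<noteq> v f} \<le> m}"
  have finA: "finite A" by (rule x.finite_alphabet)
  have fin: "finite (F \<rightarrow>\<^sub>E A)" using F finA by (intro finite_PiE) auto
  have "x'.patterns F \<subseteq> (\<Union>v\<in>x.patterns F. ?ball v)"
  proof
    fix w assume w: "w \<in> x'.patterns F"
    then obtain g where g: "g \<in> carrier G" "w = (\<lambda>f\<in>F. x' (f \<otimes>\<^bsub>G\<^esub> g))"
      unfolding x'.patterns_def by blast
    define v where "v = (\<lambda>f\<in>F. x (f \<otimes>\<^bsub>G\<^esub> g))"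
    have v: "v \<in> x.patterns F" unfolding x.patterns_def v_def using g(1) by (rule imageI)
    have "card {f\<in>F. w f \<noteq> v f} \<le> card ({g \<in> carrier G. x g \<noteq> x' g} \<inter> (F #>\<^bsub>G\<^esub> g))"
    proof (rule card_inj_on_le[of "\<lambda>f. f \<otimes>\<^bsub>G\<^esub> g"])
      show "inj_on (\<lambda>f. f \<otimes>\<^bsub>G\<^esub> g) {f\<in>F. w f \<noteq> v f}"
        using g(1) F by (auto intro!: inj_onI simp: subset_iff)
      show "(\<lambda>f. f \<otimes>\<^bsub>G\<^esub> g) ` {f\<in>F. w f \<noteq> v f} \<subseteq> {g \<in> carrier G. x g \<noteq> x' g} \<inter> (F #>\<^bsub>G\<^esub> g)"
        using g F by (auto simp: v_def r_coset_def)
      show "finite ({g \<in> carrier G. x g \<noteq> x' g} \<inter> (F #>\<^bsub>G\<^esub> g))"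
        using F by (auto simp: r_coset_def)
    qed
    then have "card {f\<in>F. w f \<noteq> v f} \<le> m" using near[OF g(1)] by linarith
    then have "w \<in> ?ball v" using w x'.patterns_subset[OF F(2)] by auto
    then show "w \<in> (\<Union>v\<in>x.patterns F. ?ball v)" using v by blast
  qed
  then have "card (x'.patterns F) \<le> card (\<Union>v\<in>x.patterns F. ?ball v)"
    using fin x.finite_patterns[OF F] by (intro card_mono) auto
  also have "\<dots> \<le> (\<Sum>v\<in>x.patterns F. card (?ball v))"
    by (rule card_UN_le[OF x.finite_patterns[OF F]])
  finally have "real (card (x'.patterns F)) \<le> real (\<Sum>v\<in>x.patterns F. card (?ball v))"
    by (rule of_nat_mono)
  also have "\<dots> = (\<Sum>v\<in>x.patterns F. real (card (?ball v)))" by (rule of_nat_sum)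
  also have "\<dots> \<le> (\<Sum>v\<in>x.patterns F. t powr (- m) * exp (card A * t * card F))"
    using card_hamming_ball_le[OF F(1) finA t] by (intro sum_mono) auto
  finally show ?thesis by simp
qed

text \<open>The parameter \<open>t\<close> of the estimate for Hamming balls stays free here. For fixed \<open>t\<close> the first error
  term tends to \<open>0\<close> with \<open>d\<close>, and the second is small with \<open>t\<close>.\<close>

lemma orbit_entropy_perturb:
  fixes t d :: real
  assumes x: "symbolic_element G A x" and x': "symbolic_element G A x'" and am: "amenable G"
    and t: "0 < t" "t \<le> 1" and d: "0 < d" and near: "Dstar G x x' < d"
  shows "real_of_ereal (orbit_entropy G A x') \<le>
    real_of_ereal (orbit_entropy G A x) + (2 * d * - ln t + card A * t)"
proof -
  interpret x: symbolic_element G A x by fact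
  interpret x': symbolic_element G A x' by fact
  obtain F where F: "folner_seq G F" using am by (auto simp: amenable_def)
  have Fn: "finite (F n)" "F n \<subseteq> carrier G" "0 < card (F n)" for n
    using F by (auto simp: folner_seq_def Fin_def card_gt_0_iff)
  obtain L where L0: "orbit_entropy G A x = ereal L \<and>
    (\<forall>F. folner_seq G F \<longrightarrow> (\<lambda>n. ln (real (card (x.patterns (F n)))) / card (F n)) \<longlonglongrightarrow> L)"
    using x.orbit_entropy_eq_pattern_growth[OF am] by (rule exE)
  have L: "orbit_entropy G A x = ereal L"
    "(\<lambda>n. ln (real (card (x.patterns (F n)))) / card (F n)) \<longlonglongrightarrow> L"
    using conjunct1[OF L0] mp[OF spec[OF conjunct2[OF L0]] F] by this
  obtain L' where L0': "orbit_entropy G A x' = ereal L' \<and>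
    (\<forall>F. folner_seq G F \<longrightarrow> (\<lambda>n. ln (real (card (x'.patterns (F n)))) / card (F n)) \<longlonglongrightarrow> L')"
    using x'.orbit_entropy_eq_pattern_growth[OF am] by (rule exE)
  have L': "orbit_entropy G A x' = ereal L'"
    "(\<lambda>n. ln (real (card (x'.patterns (F n)))) / card (F n)) \<longlonglongrightarrow> L'"
    using conjunct1[OF L0'] mp[OF spec[OF conjunct2[OF L0']] F] by this
  let ?c = "2 * d * - ln t + card A * t"
  have "L' \<le> L + ?c"
  proof (rule tendsto_le[OF _ tendsto_add[OF L(2) tendsto_const] L'(2)])
    from x.small_upper_banach_density[OF F near[unfolded Dstar_def] d]
    show "\<forall>\<^sub>F n in sequentially. ln (real (card (x'.patterns (F n)))) / card (F n)
      \<le> ln (real (card (x.patterns (F n)))) / card (F n) + ?c"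
    proof eventually_elim
      case (elim n)
      have pos: "0 < card (x.patterns (F n))" "0 < card (x'.patterns (F n))"
        using x.card_patterns_pos[OF Fn(1,2)[of n]] x'.card_patterns_pos[OF Fn(1,2)[of n]] by this
      let ?m = "2 * d * card (F n)"
      have "real (card (x'.patterns (F n)))
          \<le> card (x.patterns (F n)) * (t powr (- ?m) * exp (card A * t * card (F n)))"
        using elim by (intro card_patterns_perturb[OF x x' Fn(1,2) t]) auto
      then have "ln (real (card (x'.patterns (F n))))
          \<le> ln (card (x.patterns (F n)) * (t powr (- ?m) * exp (card A * t * card (F n))))"
        using pos by (intro ln_mono) auto
      also have "\<dots> = ln (card (x.patterns (F n))) + (- ?m * ln t + card A * t * card (F n))"
        using pos t by (simp add: ln_mult ln_powr)
      also have "\<dots> = ln (card (x.patterns (F n))) + ?c * card (F n)"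
        by (simp add: algebra_simps)
      finally show ?case using Fn(3)[of n] by (simp add: divide_simps algebra_simps)
    qed
  qed simp
  then show ?thesis by (simp add: L(1) L'(1))
qed

theorem theorem32:
  fixes G :: "('g, 'm) monoid_scheme" and A :: "'a set"
  assumes "group G" and "countable (carrier G)" and "amenable G"
    and "finite A"
  shows "(\<forall>x\<in>topspace (full_shift G A). \<bar>orbit_entropy G A x\<bar> \<noteq> \<infinity>) \<and>
    (\<forall>x\<in>topspace (full_shift G A). \<forall>\<epsilon>>0. \<exists>\<delta>>0. \<forall>x'\<in>topspace (full_shift G A).
       Dstar G x x' < \<delta> \<longrightarrow>
       dist (real_of_ereal (orbit_entropy G A x)) (real_of_ereal (orbit_entropy G A x')) < \<epsilon>)"
proof -
  have sym: "symbolic_element G A x" if "x \<in> topspace (full_shift G A)" for x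
    using assms(1,4) that by (simp add: symbolic_element_def symbolic_element_axioms_def)
  have finite: "\<bar>orbit_entropy G A x\<bar> \<noteq> \<infinity>" if "x \<in> topspace (full_shift G A)" for x
    using symbolic_element.orbit_entropy_eq_pattern_growth[OF sym[OF that] assms(3)] by auto
  have cont: "\<exists>\<delta>>0. \<forall>x'\<in>topspace (full_shift G A). Dstar G x x' < \<delta> \<longrightarrow>
      dist (real_of_ereal (orbit_entropy G A x)) (real_of_ereal (orbit_entropy G A x')) < \<epsilon>"
    if x: "x \<in> topspace (full_shift G A)" and e: "0 < \<epsilon>" for x and \<epsilon> :: real
  proof -
    \<comment> \<open>First \<open>t\<close> makes \<open>|A| t\<close> small, and then \<open>d\<close>, depending on \<open>t\<close>, makes \<open>- 2 d ln t\<close> small. The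
        summand \<open>1\<close> in \<open>d\<close> covers the case \<open>t = 1\<close>, where \<open>ln t = 0\<close>.\<close>
    define t where "t = min 1 (\<epsilon> / (4 * (real (card A) + 1)))"
    have t: "0 < t" "t \<le> 1" using e by (auto simp: t_def)
    have "card A * t \<le> card A * (\<epsilon> / (4 * (real (card A) + 1)))"
      by (intro mult_left_mono) (auto simp: t_def)
    also have "\<dots> \<le> \<epsilon> / 4" using e by (simp add: field_simps)
    finally have At: "card A * t \<le> \<epsilon> / 4" .
    define d where "d = \<epsilon> / (8 * (1 - ln t))"
    have lnt: "ln t \<le> 0" using t by simp
    then have d: "0 < d" using e by (simp add: d_def)
    have "2 * d * - ln t \<le> 2 * d * (1 - ln t)" using d by (intro mult_left_mono) auto
    also have "\<dots> = \<epsilon> / 4" using lnt by (simp add: d_def field_simps)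
    finally have cost: "2 * d * - ln t + card A * t < \<epsilon>" using At e by linarith
    have "dist (real_of_ereal (orbit_entropy G A x)) (real_of_ereal (orbit_entropy G A x')) < \<epsilon>"
      if x': "x' \<in> topspace (full_shift G A)" and near: "Dstar G x x' < d" for x'
    proof -
      have "Dstar G x' x < d" using near by (simp add: Dstar_def eq_commute)
      from orbit_entropy_perturb[OF sym[OF x'] sym[OF x] assms(3) t d this]
        orbit_entropy_perturb[OF sym[OF x] sym[OF x'] assms(3) t d near]
      show ?thesis using cost unfolding dist_real_def by linarith
    qed
    then show ?thesis using d by (intro exI[of _ d]) auto
  qed
  show ?thesis
    by (intro conjI ballI allI impI finite cont)
qed

end
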